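(* Let $U\subset\mathbb{R}$ be an open set and let $f\in L^2_{\mathrm{loc}}(U)$ be real valued. Then at almost every point $x\in\{x\in U: A(f)(x)=\infty\}$ one has $$\limsup_{h\to 0^+}\frac{|\tilde\Delta(f)(x,h)|}{\sqrt{A^2(f)(x,h)\,\ln\ln A^2(f)(x,h)}}\le\sqrt{2\ln 2}.$$
   Context: For $t\neq 0$ with $s-t,s,s+t\in U$, set $\Delta(f)(s,t)=\frac{f(s+t)-f(s-t)}{2|t|}$ and $\Delta_2(f)(s,t)=\frac{f(s+t)+f(s-t)-2f(s)}{2|t|}$. For $x\in U$ let $h_0=h_0(x)=\min\{1,\operatorname{dist}(x,\mathbb{R}\setminus U)/2\}$ (with $h_0=1$ if $U=\mathbb{R}$), and let $\Gamma(x)=\{(s,t)\in\mathbb{R}^2: |s-x|<t<h_0\}$. The conical square function and its truncations are defined, with values in $[0,\infty]$, by $$A^2(f)(x)=\int_{\Gamma(x)}\Delta_2^2(f)(s,t)\,\frac{ds\,dt}{t^2},\qquad A^2(f)(x,h)=\int_{\Gamma(x)\cap\{t\ge h\}}\Delta_2^2(f)(s,t)\,\frac{ds\,dt}{t^2},$$ where $\Delta_2^2(f)=(\Delta_2(f))^2$, $A^2(f)(x)=(A(f)(x))^2$ and $A^2(f)(x,h)=(A(f)(x,h))^2$. The mean divided difference is, for $0<h<h_0(x)$, $$\tilde\Delta(f)(x,h)=\int_{h/2}^{h}\int_{x-t}^{x+t}\Delta(f)(s,t)\,\frac{ds\,dt}{2t^2}.$$ "Almost every" refers to Lebesgue measure.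 *)

theory Defs
  imports "HOL-Analysis.Analysis"
begin

definition L2_loc :: "real set \<Rightarrow> (real \<Rightarrow> real) \<Rightarrow> bool" where
  "L2_loc U f \<longleftrightarrow> f \<in> borel_measurable (lebesgue_on U) \<and>
     (\<forall>K. compact K \<and> K \<subseteq> U \<longrightarrow> set_integrable lebesgue K (\<lambda>x. (f x)\<^sup>2))"

text \<open>
  A function on \<open>U\<close> is represented by a total function on the reals. The two difference
  quotients are only evaluated below at \<open>t \<noteq> 0\<close> and \<open>s - t, s, s + t \<in> U\<close>, so values
  of the function outside \<open>U\<close> never matter.
\<close>

definition Delta :: "(real \<Rightarrow> real) \<Rightarrow> real \<Rightarrow> real \<Rightarrow> real" where
  "Delta f s t = (f (s + t) - f (s - t)) / (2 * \<bar>t\<bar>)"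

definition Delta2 :: "(real \<Rightarrow> real) \<Rightarrow> real \<Rightarrow> real \<Rightarrow> real" where
  "Delta2 f s t = (f (s + t) + f (s - t) - 2 * f s) / (2 * \<bar>t\<bar>)"

text \<open>The case distinction is needed because \<^term>\<open>infdist x {} = 0\<close>.\<close>

definition h0 :: "real set \<Rightarrow> real \<Rightarrow> real" where
  "h0 U x = (if U = UNIV then 1 else min 1 (infdist x (- U) / 2))"

definition cone :: "real set \<Rightarrow> real \<Rightarrow> (real \<times> real) set" where
  "cone U x = {(s, t). \<bar>s - x\<bar> < t \<and> t < h0 U x}"

text \<open>
  Extensions of the square root and the logarithm by the value \<open>\<infinity>\<close> at \<open>\<infinity>\<close>. On finite
  arguments they are the real functions (with the library's values where the real functions
  are not defined mathematically).
\<close>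

definition esqrt :: "ereal \<Rightarrow> ereal" where
  "esqrt a = (if a = \<infinity> then \<infinity> else ereal (sqrt (real_of_ereal a)))"

definition eln :: "ereal \<Rightarrow> ereal" where
  "eln a = (if a = \<infinity> then \<infinity> else ereal (ln (real_of_ereal a)))"

text \<open>
  The squares of the conical square function and of its truncation, with values in \<open>[0,\<infinity>]\<close>.
  The truncation can itself be infinite, since \<open>f\<close> need not be square integrable up to the
  boundary of \<open>U\<close>.
\<close>

definition A_sq :: "real set \<Rightarrow> (real \<Rightarrow> real) \<Rightarrow> real \<Rightarrow> ereal" where
  "A_sq U f x = enn2ereal
     (\<integral>\<^sup>+p\<in>cone U x. ennreal ((Delta2 f (fst p) (snd p))\<^sup>2 / (snd p)\<^sup>2) \<partial>lebesgue)"

definition A_sq_trunc :: "real set \<Rightarrow> (real \<Rightarrow> real) \<Rightarrow> real \<Rightarrow> real \<Rightarrow> ereal" where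
  "A_sq_trunc U f x h = enn2ereal
     (\<integral>\<^sup>+p\<in>cone U x \<inter> {p. h \<le> snd p}.
        ennreal ((Delta2 f (fst p) (snd p))\<^sup>2 / (snd p)\<^sup>2) \<partial>lebesgue)"

definition A :: "real set \<Rightarrow> (real \<Rightarrow> real) \<Rightarrow> real \<Rightarrow> ereal" where
  "A U f x = esqrt (A_sq U f x)"

text \<open>
  Meaningful for \<open>0 < h < h0 U x\<close>: then all points \<open>s - t, s, s + t\<close> that occur lie in a
  compact subset of \<open>U\<close>.
\<close>

definition mean_Delta :: "(real \<Rightarrow> real) \<Rightarrow> real \<Rightarrow> real \<Rightarrow> real" where
  "mean_Delta f x h =
     (LINT t:{h/2..h}|lebesgue. (LINT s:{x - t..x + t}|lebesgue. Delta f s t / (2 * t\<^sup>2)))"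

end

theory Submission
  imports Defs "HOL-Real_Asymp.Real_Asymp"
begin

text \<open>
  For a point \<open>x\<close> and an interval \<open>[s - t, s + t]\<close> containing it, the divided difference
  \<open>\<Delta>(f)(s, t)\<close> changes by \<open>\<plusminus> \<Delta>\<^sub>2(f)(s, t)\<close> when the interval is replaced by its half
  containing \<open>x\<close>: along dyadic descent the divided differences form a martingale \<open>M\<close> with
  quadratic variation \<open>Q = \<Sum> \<Delta>\<^sub>2\<^sup>2\<close>. Averaging over all starting intervals, with respect to
  \<open>ds dt / t\<^sup>2\<close>, turns \<open>M\<close> into the mean divided difference and \<open>Q\<close> into the truncated conical
  square function. Since \<open>exp (\<lambda>M - \<lambda>\<^sup>2Q/2)\<close> is a supermartingale, a Bellman function argument
  bounds the integral of the running maximum of its power \<open>2/3\<close>, uniformly in \<open>\<lambda>\<close>; Jensen's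
  inequality moves the average over the intervals into the exponent. Using this for a sequence
  of values \<open>\<lambda>\<^sub>k\<close> adapted to \<open>A\<^sup>2 \<approx> exp k\<close> and the Borel-Cantelli lemma gives the law of the
  iterated logarithm. The average costs less than the constant \<open>\<surd>(2 ln 2)\<close> allows for (the
  martingale bound would give \<open>\<surd>(ln 2)\<close>), which is why the power \<open>2/3\<close> and geometric blocks of
  ratio \<open>exp 1\<close> suffice.
\<close>

section \<open>Dyadic descent and the running maximum\<close>

text \<open>
  Relative to a fixed point \<open>x\<close>, a pair \<open>(t, w)\<close> with \<open>t > 0\<close> and \<open>-1 \<le> w < 1\<close> stands for the interval
  of centre \<open>s = x - t w\<close> and half-length \<open>t\<close>, so that \<open>w\<close> is the relative position of \<open>x\<close> in it;
  \<open>descend\<close> passes to the half containing \<open>x\<close>.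
\<close>

definition half_sign :: "real \<Rightarrow> real" where
  "half_sign w = (if w < 0 then - 1 else 1)"

definition descend :: "real \<times> real \<Rightarrow> real \<times> real" where
  "descend p = (fst p / 2, 2 * snd p - half_sign (snd p))"

definition slope :: "(real \<Rightarrow> real) \<Rightarrow> real \<Rightarrow> real \<times> real \<Rightarrow> real" where
  "slope f x p = Delta f (x - fst p * snd p) (fst p)"

definition slope_jump :: "(real \<Rightarrow> real) \<Rightarrow> real \<Rightarrow> real \<times> real \<Rightarrow> real" where
  "slope_jump f x p = Delta2 f (x - fst p * snd p) (fst p)"

text \<open>
  The maximum of \<open>m\<close> and of the first \<open>n + 1\<close> values of \<open>exp (2/3 (L + \<lambda>M - \<lambda>\<^sup>2Q/2))\<close> along the
  descent from \<open>p\<close>, where \<open>M\<close> and \<open>Q\<close> start at \<open>0\<close>; carrying \<open>L\<close> and \<open>m\<close> along makes the induction work.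
\<close>

fun run_max :: "(real \<Rightarrow> real) \<Rightarrow> real \<Rightarrow> real \<Rightarrow> nat \<Rightarrow> real \<Rightarrow> real \<Rightarrow> real \<times> real \<Rightarrow> real" where
  "run_max f l x 0 L m p = max m (exp (2 / 3 * L))"
| "run_max f l x (Suc n) L m p =
     run_max f l x n
       (L + l * half_sign (snd p) * slope_jump f x p - l\<^sup>2 / 2 * (slope_jump f x p)\<^sup>2)
       (max m (exp (2 / 3 * L))) (descend p)"

text \<open>The slope over an interval is the mean of the slopes over its two halves, and
  \<open>Delta2\<close> is half their difference. This is the martingale property; the sign records
  which half contains \<open>x\<close>.\<close>

lemma slope_descend:
  assumes "fst p > 0"
  shows "slope f x (descend p) = slope f x p + half_sign (snd p) * slope_jump f x p"
proof -
  obtain t w where p: "p = (t, w)" by (cases p)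
  have t: "t > 0" using assms p by simp
  define a b c where "a = f (x - t * w - t)" and "b = f (x - t * w)" and "c = f (x - t * w + t)"
  have *: "x - t / 2 * (2 * w + 1) + t / 2 = x - t * w" "x - t / 2 * (2 * w + 1) - t / 2 = x - t * w - t"
    "x - t / 2 * (2 * w - 1) + t / 2 = x - t * w + t" "x - t / 2 * (2 * w - 1) - t / 2 = x - t * w"
    by (simp_all add: field_simps)
  have "(b - a) / (2 * \<bar>t / 2\<bar>) = (c - a) / (2 * \<bar>t\<bar>) - (c + a - 2 * b) / (2 * \<bar>t\<bar>)"
    "(c - b) / (2 * \<bar>t / 2\<bar>) = (c - a) / (2 * \<bar>t\<bar>) + (c + a - 2 * b) / (2 * \<bar>t\<bar>)"
    "- ((c + a - 2 * b) / (2 * \<bar>t\<bar>)) = (2 * b - (c + a)) / (2 * \<bar>t\<bar>)"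
    using t by (simp_all add: field_simps)
  then show ?thesis
    by (cases "w < 0")
      (simp_all add: p slope_def slope_jump_def descend_def half_sign_def Delta_def Delta2_def * a_def b_def c_def
         del: abs_divide times_divide_eq_left)
qed

lemma run_max_ge_start: "max m (exp (2 / 3 * L)) \<le> run_max f l x n L m p"
proof (induction n arbitrary: L m p)
  case (Suc n)
  show ?case unfolding run_max.simps(2) by (rule order_trans[OF max.cobounded1 Suc.IH])
qed simp

text \<open>Monotone convergence then carries the bound that is uniform in \<open>n\<close> over to
  the supremum over \<open>n\<close>.\<close>

lemma run_max_mono: "run_max f l x n L m p \<le> run_max f l x (Suc n) L m p"
proof (induction n arbitrary: L m p)
  case 0
  then show ?case using run_max_ge_start[of "max m (exp (2 / 3 * L))" _ f l x 0] by simp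
next
  case (Suc n)
  show ?case unfolding run_max.simps(2)[of f l x n L m p] run_max.simps(2)[of f l x "Suc n" L m p]
    by (rule Suc.IH)
qed

text \<open>The increments \<open>half_sign * slope_jump\<close> telescope by
  \<open>slope_descend\<close>, so the accumulated \<open>L\<close> is the exponent of the
  exponential supermartingale.\<close>

lemma run_max_ge:
  assumes "fst p > 0"
  shows "exp (2 / 3 * (L + l * (slope f x ((descend ^^ n) p) - slope f x p)
            - l\<^sup>2 / 2 * (\<Sum>k<n. (slope_jump f x ((descend ^^ k) p))\<^sup>2)))
         \<le> run_max f l x n L m p"
  using assms
proof (induction n arbitrary: L m p)
  case 0
  then show ?case by simp
next
  case (Suc n)
  have "fst (descend p) > 0" using Suc.prems by (simp add: descend_def)
  note IH = Suc.IH[OF this]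
  have sp: "(descend ^^ Suc k) p = (descend ^^ k) (descend p)" for k
    by (simp add: funpow_swap1)
  have sum: "(\<Sum>k<Suc n. (slope_jump f x ((descend ^^ k) p))\<^sup>2) =
     (slope_jump f x p)\<^sup>2 + (\<Sum>k<n. (slope_jump f x ((descend ^^ k) (descend p)))\<^sup>2)"
    by (subst sum.lessThan_Suc_shift) (simp add: funpow_swap1)
  have eq: "L + l * (slope f x ((descend ^^ Suc n) p) - slope f x p)
            - l\<^sup>2 / 2 * (\<Sum>k<Suc n. (slope_jump f x ((descend ^^ k) p))\<^sup>2) =
        (L + l * half_sign (snd p) * slope_jump f x p - l\<^sup>2 / 2 * (slope_jump f x p)\<^sup>2)
          + l * (slope f x ((descend ^^ n) (descend p)) - slope f x (descend p))
            - l\<^sup>2 / 2 * (\<Sum>k<n. (slope_jump f x ((descend ^^ k) (descend p)))\<^sup>2)"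
    unfolding sum sp slope_descend[OF Suc.prems, of f x] by (simp add: algebra_simps)
  show ?case unfolding run_max.simps(2) eq by (rule IH)
qed

text \<open>Power series are compared term by term, using
  \<open>2 ^ k * fact k \<le> fact (2 * k)\<close>. This is the inequality behind the
  supermartingale property: a random sign times \<open>y\<close> has exponential mean
  \<open>cosh y\<close>.\<close>

lemma cosh_le_exp_half_square: "cosh y \<le> exp (y\<^sup>2 / 2)" for y :: real
proof (rule sums_le)
  show "(\<lambda>n. if even n then y ^ n / fact n else 0) sums cosh y"
    using cosh_converges[of y] by (rule back_subst[of "\<lambda>g. g sums cosh y"]) (auto simp: fun_eq_iff field_simps)
  have "(\<lambda>n. (y\<^sup>2 / 2) ^ n / fact n) sums exp (y\<^sup>2 / 2)"
    using exp_converges[of "y\<^sup>2 / 2"] by (simp add: scaleR_conv_of_real field_simps)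
  then show "(\<lambda>n. if even n then (y\<^sup>2 / 2) ^ (n div 2) / fact (n div 2) else 0) sums exp (y\<^sup>2 / 2)"
    using sums_mono_reindex[of "\<lambda>n. 2 * n" "\<lambda>n. if even n then (y\<^sup>2 / 2) ^ (n div 2) / fact (n div 2) else 0"]
    by (force simp: strict_mono_def elim!: evenE)
  have fact: "2 ^ k * fact k \<le> (fact (2 * k) :: real)" for k
  proof (induction k)
    case (Suc k)
    have "2 ^ Suc k * fact (Suc k) = (2 * real k + 2) * (2 ^ k * fact k)" by (simp add: algebra_simps)
    also have "\<dots> \<le> (2 * real k + 2) * fact (2 * k)" by (intro mult_left_mono Suc) simp
    also have "\<dots> \<le> (2 * real k + 2) * ((2 * real k + 1) * fact (2 * k))"
      by (intro mult_left_mono) (auto simp: algebra_simps)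
    also have "\<dots> = fact (2 * Suc k)" by (simp add: algebra_simps)
    finally show ?case .
  qed simp
  show "(if even n then y ^ n / fact n else 0)
      \<le> (if even n then (y\<^sup>2 / 2) ^ (n div 2) / fact (n div 2) else 0)" for n
  proof (cases "even n")
    case True
    then obtain k where k: "n = 2 * k" by (auto elim: evenE)
    have "(y\<^sup>2) ^ k / fact (2 * k) \<le> (y\<^sup>2) ^ k / (2 ^ k * fact k)"
      by (intro divide_left_mono fact) auto
    then show ?thesis by (simp add: k power_mult power_divide)
  qed simp
qed

text \<open>
  \<open>m + 2 exp L / \<surd>m\<close> is the Bellman function: it bounds the mean of \<open>max m (sup\<^sub>n G\<^sub>n powr (2/3))\<close>
  for a nonnegative supermartingale \<open>G\<close> started at \<open>exp L\<close>, by the weak-type maximal inequality.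
\<close>

lemma bellman_max:
  fixes m L :: real
  assumes "m > 0"
  defines "m' \<equiv> max m (exp (2 / 3 * L))"
  shows "m' + 2 * exp L / sqrt m' \<le> m + 2 * exp L / sqrt m"
proof (cases "exp (2 / 3 * L) \<le> m")
  case True
  then show ?thesis by (simp add: m'_def)
next
  case False
  define r s where "r = exp (L / 3)" and "s = sqrt m"
  have r: "r > 0" and s: "s > 0" using assms by (auto simp: r_def s_def)
  have r2: "exp (2 / 3 * L) = r\<^sup>2" and r3: "exp L = r ^ 3"
    by (simp_all add: r_def flip: exp_of_nat_mult)
  have m: "m = s\<^sup>2" using assms by (simp add: s_def)
  \<comment> \<open>In terms of \<open>r\<close> and \<open>s\<close> the claim is
    \<open>3 * r^2 * s \<le> s^3 + 2 * r^3\<close>, and the difference of the two sides factors as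
    this product.\<close>
  have "0 \<le> (r - s)\<^sup>2 * (2 * r + s)" using r s by simp
  then have "3 * r\<^sup>2 * s \<le> s ^ 3 + 2 * r ^ 3"
    by (simp add: power2_eq_square power3_eq_cube algebra_simps)
  then have "r\<^sup>2 + 2 * r\<^sup>2 \<le> s\<^sup>2 + 2 * r ^ 3 / s"
    using s by (simp add: field_simps power2_eq_square power3_eq_cube)
  moreover have "m' = r\<^sup>2" using False r2 by (simp add: m'_def max_def)
  moreover have "2 * r ^ 3 / r = 2 * r\<^sup>2" using r by (simp add: power2_eq_square power3_eq_cube)
  ultimately show ?thesis using r s by (simp add: m r3)
qed

section \<open>Measurability along the descent\<close>

lemma measurable_half_sign [measurable]: "half_sign \<in> borel_measurable borel"
  unfolding half_sign_def[abs_def] by measurable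

lemma measurable_descend [measurable]: "descend \<in> borel \<Otimes>\<^sub>M borel \<rightarrow>\<^sub>M borel \<Otimes>\<^sub>M borel"
  unfolding descend_def[abs_def] by measurable

lemma measurable_Delta [measurable]:
  assumes [measurable]: "f \<in> borel_measurable borel" "S \<in> borel_measurable M" "T \<in> borel_measurable M"
  shows "(\<lambda>z. Delta f (S z) (T z)) \<in> borel_measurable M" "(\<lambda>z. Delta2 f (S z) (T z)) \<in> borel_measurable M"
  unfolding Delta_def Delta2_def by measurable

lemma measurable_slope [measurable]:
  assumes [measurable]: "f \<in> borel_measurable borel" "X \<in> borel_measurable M" "P \<in> M \<rightarrow>\<^sub>M borel \<Otimes>\<^sub>M borel"
  shows "(\<lambda>z. slope f (X z) (P z)) \<in> borel_measurable M" "(\<lambda>z. slope_jump f (X z) (P z)) \<in> borel_measurable M"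
  unfolding slope_def slope_jump_def by measurable

lemma measurable_run_max [measurable]:
  assumes "f \<in> borel_measurable borel" "X \<in> borel_measurable M"
    and "L \<in> borel_measurable M" "m \<in> borel_measurable M" "P \<in> M \<rightarrow>\<^sub>M borel \<Otimes>\<^sub>M borel"
  shows "(\<lambda>z. run_max f l (X z) n (L z) (m z) (P z)) \<in> borel_measurable M"
  using assms
proof (induction n arbitrary: L m P)
  case 0
  note [measurable] = this
  show ?case unfolding run_max.simps by measurable
next
  case (Suc n)
  note [measurable] = Suc.prems
  show ?case unfolding run_max.simps by (rule Suc.IH; measurable)
qed

section \<open>Averaging over the position of the point in its interval\<close>

lemma nn_integral_double_pos:
  fixes h :: "real \<Rightarrow> ennreal"
  assumes [measurable]: "h \<in> borel_measurable borel"
  shows "(\<integral>\<^sup>+w\<in>{0..<1}. h (2 * w - 1) \<partial>lborel) = ennreal (1 / 2) * (\<integral>\<^sup>+w\<in>{-1..<1}. h w \<partial>lborel)"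
proof -
  have "indicator {0..<1} (1 / 2 + 1 / 2 * u) = (indicator {-1..<1} u :: ennreal)" for u :: real
    by (auto simp: indicator_def)
  then show ?thesis
    by (subst nn_integral_real_affine[where c = "1 / 2" and t = "1 / 2"]) (simp_all add: algebra_simps)
qed

lemma nn_integral_double_neg:
  fixes h :: "real \<Rightarrow> ennreal"
  assumes [measurable]: "h \<in> borel_measurable borel"
  shows "(\<integral>\<^sup>+w\<in>{-1..<0}. h (2 * w + 1) \<partial>lborel) = ennreal (1 / 2) * (\<integral>\<^sup>+w\<in>{-1..<1}. h w \<partial>lborel)"
proof -
  have "indicator {-1..<0} (- 1 / 2 + 1 / 2 * u) = (indicator {-1..<1} u :: ennreal)" for u :: real
    by (auto simp: indicator_def)
  then show ?thesis
    by (subst nn_integral_real_affine[where c = "1 / 2" and t = "- 1 / 2"]) (simp_all add: algebra_simps)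
qed

lemma nn_integral_split_half:
  fixes h :: "real \<Rightarrow> ennreal"
  assumes [measurable]: "h \<in> borel_measurable borel"
  shows "(\<integral>\<^sup>+w\<in>{-1..<1}. h w \<partial>lborel) = (\<integral>\<^sup>+w\<in>{-1..<0}. h w \<partial>lborel) + (\<integral>\<^sup>+w\<in>{0..<1}. h w \<partial>lborel)"
proof -
  have "(\<integral>\<^sup>+w\<in>{-1..<1}. h w \<partial>lborel)
      = (\<integral>\<^sup>+w. h w * indicator {-1..<0} w + h w * indicator {0..<1} w \<partial>lborel)"
    by (intro nn_integral_cong) (auto simp: indicator_def)
  then show ?thesis by (simp add: nn_integral_add)
qed

lemma ennreal_half_add_half: "ennreal (1 / 2) * X + ennreal (1 / 2) * X = X"
proof -
  have "ennreal (1 / 2) + ennreal (1 / 2) = 1" by (simp flip: ennreal_plus del: ennreal_half)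
  then show ?thesis by (metis distrib_right mult_1)
qed

text \<open>This is the doubling map of the circle: it stretches each half of \<open>[-1, 1)\<close>
  onto the whole by a factor 2, so each half contributes half of the integral.\<close>

lemma nn_integral_double:
  fixes h :: "real \<Rightarrow> ennreal"
  assumes [measurable]: "h \<in> borel_measurable borel"
  shows "(\<integral>\<^sup>+w\<in>{-1..<1}. h (2 * w - half_sign w) \<partial>lborel) = (\<integral>\<^sup>+w\<in>{-1..<1}. h w \<partial>lborel)"
proof -
  have "(\<integral>\<^sup>+w\<in>{-1..<0}. h (2 * w - half_sign w) \<partial>lborel) = (\<integral>\<^sup>+w\<in>{-1..<0}. h (2 * w + 1) \<partial>lborel)"
    "(\<integral>\<^sup>+w\<in>{0..<1}. h (2 * w - half_sign w) \<partial>lborel) = (\<integral>\<^sup>+w\<in>{0..<1}. h (2 * w - 1) \<partial>lborel)"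
    by (auto intro!: nn_integral_cong simp: indicator_def half_sign_def)
  then show ?thesis
    by (subst nn_integral_split_half)
      (simp_all add: nn_integral_double_pos nn_integral_double_neg ennreal_half_add_half del: ennreal_half)
qed

text \<open>The interval with centre \<open>s\<close> and half-length \<open>t\<close> is fixed and
  the point \<open>s + t * w\<close> varies in it. Each half of the interval is again such an
  interval, so induction applies: averaging over the two halves does not increase
  \<open>exp L\<close>, and \<open>bellman_max\<close> absorbs the update of \<open>m\<close>. The
  outer factor 2 is the length of \<open>[-1, 1)\<close>.\<close>

lemma nn_integral_run_max:
  assumes [measurable]: "f \<in> borel_measurable borel" and m: "m > 0"
  shows "(\<integral>\<^sup>+w\<in>{-1..<1}. ennreal (run_max f l (s + t * w) n L m (t, w)) \<partial>lborel)
     \<le> ennreal (2 * (m + 2 * exp L / sqrt m))"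
  using m
proof (induction n arbitrary: s t L m)
  case 0
  let ?m' = "max m (exp (2 / 3 * L))"
  have "?m' \<le> ?m' + 2 * exp L / sqrt ?m'" using 0 by simp
  also have "\<dots> \<le> m + 2 * exp L / sqrt m" by (rule bellman_max[OF 0])
  finally have "ennreal (2 * ?m') \<le> ennreal (2 * (m + 2 * exp L / sqrt m))"
    by (intro ennreal_leI mult_left_mono) auto
  moreover have "ennreal (2 * ?m') = ennreal ?m' * 2"
    using 0 by (subst ennreal_mult) (auto simp: mult.commute)
  ultimately show ?case
    by (simp add: nn_integral_cmult)
next
  case (Suc n)
  define m' where "m' = max m (exp (2 / 3 * L))"
  define E where "E = Delta2 f s t"
  define Lp where "Lp = L + l * E - l\<^sup>2 / 2 * E\<^sup>2"
  define Lm where "Lm = L - l * E - l\<^sup>2 / 2 * E\<^sup>2"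
  have m': "m' > 0" using Suc.prems by (simp add: m'_def)
  \<comment> \<open>For \<open>w < 0\<close> the point lies in the left half, which has centre
    \<open>s - t / 2\<close> and half-length \<open>t / 2\<close>; its relative position there is
    \<open>2 * w + 1\<close>, and \<open>L\<close> moves to \<open>Lm\<close>.\<close>
  have neg: "(\<integral>\<^sup>+w\<in>{-1..<0}. ennreal (run_max f l (s + t * w) (Suc n) L m (t, w)) \<partial>lborel)
     = (\<integral>\<^sup>+w\<in>{-1..<0}. ennreal (run_max f l (s - t / 2 + t / 2 * (2 * w + 1)) n Lm m' (t / 2, 2 * w + 1)) \<partial>lborel)"
    by (intro nn_integral_cong)
      (auto simp: indicator_def half_sign_def descend_def slope_jump_def m'_def E_def Lm_def algebra_simps)
  have pos: "(\<integral>\<^sup>+w\<in>{0..<1}. ennreal (run_max f l (s + t * w) (Suc n) L m (t, w)) \<partial>lborel)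
     = (\<integral>\<^sup>+w\<in>{0..<1}. ennreal (run_max f l (s + t / 2 + t / 2 * (2 * w - 1)) n Lp m' (t / 2, 2 * w - 1)) \<partial>lborel)"
    by (intro nn_integral_cong)
      (auto simp: indicator_def half_sign_def descend_def slope_jump_def m'_def E_def Lp_def algebra_simps)
  have "(\<integral>\<^sup>+w\<in>{-1..<1}. ennreal (run_max f l (s + t * w) (Suc n) L m (t, w)) \<partial>lborel)
    = ennreal (1 / 2) * (\<integral>\<^sup>+w\<in>{-1..<1}. ennreal (run_max f l (s - t / 2 + t / 2 * w) n Lm m' (t / 2, w)) \<partial>lborel)
    + ennreal (1 / 2) * (\<integral>\<^sup>+w\<in>{-1..<1}. ennreal (run_max f l (s + t / 2 + t / 2 * w) n Lp m' (t / 2, w)) \<partial>lborel)"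
    apply (subst nn_integral_split_half)
     apply measurable
    unfolding neg pos
    apply (subst nn_integral_double_neg[where h = "\<lambda>w. ennreal (run_max f l (s - t / 2 + t / 2 * w) n Lm m' (t / 2, w))"])
     apply measurable
    apply (subst nn_integral_double_pos[where h = "\<lambda>w. ennreal (run_max f l (s + t / 2 + t / 2 * w) n Lp m' (t / 2, w))"])
     apply measurable
    done
  also have "\<dots> \<le> ennreal (1 / 2) * ennreal (2 * (m' + 2 * exp Lm / sqrt m'))
    + ennreal (1 / 2) * ennreal (2 * (m' + 2 * exp Lp / sqrt m'))"
    by (intro add_mono mult_left_mono Suc.IH m') auto
  also have "\<dots> = ennreal (2 * m' + 2 * (exp Lm + exp Lp) / sqrt m')"
  proof -
    have half: "ennreal (1 / 2) * ennreal (2 * y) = ennreal y" for y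
      by (subst ennreal_mult'[symmetric]) auto
    have "(m' + 2 * exp Lm / sqrt m') + (m' + 2 * exp Lp / sqrt m') = 2 * m' + 2 * (exp Lm + exp Lp) / sqrt m'"
      by (simp add: add_divide_distrib)
    then show ?thesis
      unfolding half using m' by (subst ennreal_plus[symmetric]) auto
  qed
  also have "\<dots> \<le> ennreal (2 * (m + 2 * exp L / sqrt m))"
  proof (rule ennreal_leI)
    \<comment> \<open>The two signs combine to a \<open>cosh\<close>, whose growth is compensated
      exactly by the quadratic term of the exponent.\<close>
    have "exp Lm + exp Lp = exp L * exp (- (l\<^sup>2 / 2 * E\<^sup>2)) * (2 * cosh (l * E))"
      by (simp add: Lm_def Lp_def cosh_field_def algebra_simps flip: exp_add)
    also have "\<dots> \<le> exp L * exp (- (l\<^sup>2 / 2 * E\<^sup>2)) * (2 * exp ((l * E)\<^sup>2 / 2))"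
      by (intro mult_left_mono cosh_le_exp_half_square) auto
    also have "\<dots> = 2 * exp L" by (simp add: power_mult_distrib exp_minus)
    finally have "2 * (exp Lm + exp Lp) / sqrt m' \<le> 2 * (2 * exp L) / sqrt m'"
      using m' by (intro divide_right_mono) auto
    then have "2 * m' + 2 * (exp Lm + exp Lp) / sqrt m' \<le> 2 * (m' + 2 * exp L / sqrt m')" by simp
    also have "\<dots> \<le> 2 * (m + 2 * exp L / sqrt m)"
      using bellman_max[OF Suc.prems, of L] by (simp add: m'_def)
    finally show "2 * m' + 2 * (exp Lm + exp Lp) / sqrt m' \<le> 2 * (m + 2 * exp L / sqrt m)" .
  qed
  finally show ?case .
qed

section \<open>The invariant measure on the cone\<close>

text \<open>The image of \<open>ds dt / t\<^sup>2\<close> under \<open>s = x - t w\<close>, whatever \<open>x\<close>. It is invariant under dyadic descent.\<close>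

definition cone_measure :: "real \<Rightarrow> real \<Rightarrow> (real \<times> real) measure" where
  "cone_measure a b = density (lborel \<Otimes>\<^sub>M lborel) (\<lambda>p. ennreal (indicator ({a<..b} \<times> {-1..<1}) p / fst p))"

lemma sets_cone_measure [measurable_cong, simp]: "sets (cone_measure a b) = sets (borel \<Otimes>\<^sub>M borel)"
  by (simp add: cone_measure_def cong: sets_pair_measure_cong)

lemma space_cone_measure [simp]: "space (cone_measure a b) = UNIV"
  by (simp add: cone_measure_def space_pair_measure)

lemma nn_integral_cone_measure:
  assumes [measurable]: "F \<in> borel_measurable (borel \<Otimes>\<^sub>M borel)"
  shows "(\<integral>\<^sup>+p. F p \<partial>cone_measure a b) =
    (\<integral>\<^sup>+t. ennreal (indicator {a<..b} t / t) * (\<integral>\<^sup>+w\<in>{-1..<1}. F (t, w) \<partial>lborel) \<partial>lborel)"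
proof -
  have "(\<integral>\<^sup>+p. F p \<partial>cone_measure a b) = (\<integral>\<^sup>+p. ennreal (indicator ({a<..b} \<times> {-1..<1}) p / fst p) * F p \<partial>(lborel \<Otimes>\<^sub>M lborel))"
    unfolding cone_measure_def by (rule nn_integral_density) measurable
  also have "\<dots> = (\<integral>\<^sup>+t. \<integral>\<^sup>+w. ennreal (indicator ({a<..b} \<times> {-1..<1}) (t, w) / fst (t, w)) * F (t, w) \<partial>lborel \<partial>lborel)"
    by (rule lborel.nn_integral_fst[symmetric]) measurable
  also have "\<dots> = (\<integral>\<^sup>+t. \<integral>\<^sup>+w. ennreal (indicator {a<..b} t / t) * (F (t, w) * indicator {-1..<1} w) \<partial>lborel \<partial>lborel)"
    by (intro nn_integral_cong) (auto simp: indicator_def)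
  finally show ?thesis by (simp add: nn_integral_cmult)
qed

text \<open>The density \<open>dt / t\<close> is invariant under scaling, so halving
  \<open>t\<close> only moves the range of heights, while the doubling map preserves
  \<open>dw\<close>.\<close>

lemma nn_integral_cone_measure_descend:
  assumes [measurable]: "F \<in> borel_measurable (borel \<Otimes>\<^sub>M borel)"
  shows "(\<integral>\<^sup>+p. F (descend p) \<partial>cone_measure a b) = (\<integral>\<^sup>+p. F p \<partial>cone_measure (a / 2) (b / 2))"
proof -
  have ind: "indicator {a<..b} (2 * t) = (indicator {a / 2<..b / 2} t :: real)" for t
    by (auto simp: indicator_def)
  have two: "ennreal 2 * ennreal (indicator {a / 2<..b / 2} t / (2 * t)) = ennreal (indicator {a / 2<..b / 2} t / t)" for t
    by (subst ennreal_mult'[symmetric]) auto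
  have "(\<integral>\<^sup>+p. F (descend p) \<partial>cone_measure a b) =
    (\<integral>\<^sup>+t. ennreal (indicator {a<..b} t / t) * (\<integral>\<^sup>+w\<in>{-1..<1}. F (t / 2, w) \<partial>lborel) \<partial>lborel)"
    by (subst nn_integral_cone_measure)
      (simp_all add: descend_def nn_integral_double[where h = "\<lambda>w. F (_, w)"])
  also have "\<dots> = ennreal 2 * (\<integral>\<^sup>+t. ennreal (indicator {a / 2<..b / 2} t / (2 * t)) * (\<integral>\<^sup>+w\<in>{-1..<1}. F (t, w) \<partial>lborel) \<partial>lborel)"
    by (subst nn_integral_real_affine[where c = 2 and t = 0]) (simp_all add: ind)
  also have "\<dots> = (\<integral>\<^sup>+t. ennreal 2 * (ennreal (indicator {a / 2<..b / 2} t / (2 * t)) * (\<integral>\<^sup>+w\<in>{-1..<1}. F (t, w) \<partial>lborel)) \<partial>lborel)"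
    by (rule nn_integral_cmult[symmetric]) measurable
  also have "\<dots> = (\<integral>\<^sup>+t. ennreal (indicator {a / 2<..b / 2} t / t) * (\<integral>\<^sup>+w\<in>{-1..<1}. F (t, w) \<partial>lborel) \<partial>lborel)"
    by (intro nn_integral_cong) (simp only: mult.assoc[symmetric] two)
  also have "\<dots> = (\<integral>\<^sup>+p. F p \<partial>cone_measure (a / 2) (b / 2))"
    by (rule nn_integral_cone_measure[symmetric]) measurable
  finally show ?thesis .
qed

lemma distr_cone_measure_descend: "distr (cone_measure a b) (borel \<Otimes>\<^sub>M borel) descend = cone_measure (a / 2) (b / 2)"
proof (rule measure_eqI)
  fix S assume "S \<in> sets (distr (cone_measure a b) (borel \<Otimes>\<^sub>M borel) descend)"
  then have [measurable]: "S \<in> sets (borel \<Otimes>\<^sub>M borel)" by simp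
  have "emeasure (distr (cone_measure a b) (borel \<Otimes>\<^sub>M borel) descend) S
      = (\<integral>\<^sup>+p. indicator S p \<partial>distr (cone_measure a b) (borel \<Otimes>\<^sub>M borel) descend)" by simp
  also have "\<dots> = (\<integral>\<^sup>+p. indicator S (descend p) \<partial>cone_measure a b)"
    by (rule nn_integral_distr) measurable
  also have "\<dots> = (\<integral>\<^sup>+p. indicator S p \<partial>cone_measure (a / 2) (b / 2))"
    by (rule nn_integral_cone_measure_descend) measurable
  also have "\<dots> = emeasure (cone_measure (a / 2) (b / 2)) S" by simp
  finally show "emeasure (distr (cone_measure a b) (borel \<Otimes>\<^sub>M borel) descend) S = emeasure (cone_measure (a / 2) (b / 2)) S" .
qed simp

lemma distr_cone_measure_descend_funpow:
  "distr (cone_measure a b) (borel \<Otimes>\<^sub>M borel) (descend ^^ n) = cone_measure (a / 2 ^ n) (b / 2 ^ n)"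
proof (induction n)
  case 0
  have "distr (cone_measure a b) (borel \<Otimes>\<^sub>M borel) (\<lambda>p. p) = cone_measure a b" by (rule distr_id2) simp
  then show ?case by (simp add: id_def)
next
  case (Suc n)
  have [measurable]: "descend ^^ n \<in> borel \<Otimes>\<^sub>M borel \<rightarrow>\<^sub>M borel \<Otimes>\<^sub>M borel"
    by (induction n) (simp_all, measurable)
  have "distr (cone_measure a b) (borel \<Otimes>\<^sub>M borel) (descend \<circ> descend ^^ n)
     = distr (distr (cone_measure a b) (borel \<Otimes>\<^sub>M borel) (descend ^^ n)) (borel \<Otimes>\<^sub>M borel) descend"
    by (rule distr_distr[symmetric]) measurable
  then show ?case by (simp add: Suc distr_cone_measure_descend field_simps o_def)
qed

lemma nn_integral_cone_measure_add:
  assumes [measurable]: "F \<in> borel_measurable (borel \<Otimes>\<^sub>M borel)" and "a \<le> b" "b \<le> c"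
  shows "(\<integral>\<^sup>+p. F p \<partial>cone_measure a c) = (\<integral>\<^sup>+p. F p \<partial>cone_measure a b) + (\<integral>\<^sup>+p. F p \<partial>cone_measure b c)"
proof -
  let ?G = "\<lambda>t. \<integral>\<^sup>+w\<in>{-1..<1}. F (t, w) \<partial>lborel"
  have "(\<integral>\<^sup>+p. F p \<partial>cone_measure a c) = (\<integral>\<^sup>+t. ennreal (indicator {a<..c} t / t) * ?G t \<partial>lborel)"
    by (rule nn_integral_cone_measure) measurable
  also have "\<dots> = (\<integral>\<^sup>+t. ennreal (indicator {a<..b} t / t) * ?G t + ennreal (indicator {b<..c} t / t) * ?G t \<partial>lborel)"
    using assms(2,3) by (intro nn_integral_cong) (auto simp: indicator_def)
  also have "\<dots> = (\<integral>\<^sup>+p. F p \<partial>cone_measure a b) + (\<integral>\<^sup>+p. F p \<partial>cone_measure b c)"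
    by (simp add: nn_integral_add nn_integral_cone_measure)
  finally show ?thesis .
qed

lemma nn_integral_cone_measure_mono:
  assumes [measurable]: "F \<in> borel_measurable (borel \<Otimes>\<^sub>M borel)" and "a \<le> a'" "b' \<le> b"
  shows "(\<integral>\<^sup>+p. F p \<partial>cone_measure a' b') \<le> (\<integral>\<^sup>+p. F p \<partial>cone_measure a b)"
  using assms(2,3) unfolding nn_integral_cone_measure[OF assms(1)]
  by (intro nn_integral_mono mult_right_mono) (auto simp: indicator_def)

lemma emeasure_cone_measure:
  assumes "0 < a" "a \<le> b"
  shows "emeasure (cone_measure a b) UNIV = ennreal (2 * (ln b - ln a))"
proof -
  have "emeasure (cone_measure a b) UNIV = (\<integral>\<^sup>+p. 1 \<partial>cone_measure a b)" by simp
  also have "\<dots> = (\<integral>\<^sup>+t. ennreal (indicator {a<..b} t / t) * 2 \<partial>lborel)"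
    by (subst nn_integral_cone_measure) simp_all
  also have "\<dots> = (\<integral>\<^sup>+t. ennreal (indicator {a<..b} t / t) \<partial>lborel) * 2"
    by (rule nn_integral_multc) measurable
  also have "(\<integral>\<^sup>+t. ennreal (indicator {a<..b} t / t) \<partial>lborel) = (\<integral>\<^sup>+t\<in>{a..b}. ennreal (1 / t) \<partial>lborel)"
    using AE_lborel_singleton[of a] by (intro nn_integral_cong_AE) (auto elim!: eventually_mono simp: indicator_def)
  also have "\<dots> = ennreal (ln b - ln a)"
    using assms by (intro nn_integral_FTC_Icc) (auto intro!: derivative_eq_intros simp: field_simps)
  also have "\<dots> * 2 = ennreal (2 * (ln b - ln a))"
    using assms by (subst mult.commute) (simp add: ennreal_mult del: right_diff_distrib_numeral)
  finally show ?thesis .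
qed

section \<open>Mean divided differences and square functions as integrals over the cone\<close>

text \<open>The tangent line of \<open>exp\<close> at the mean of \<open>Z\<close> is integrated.
  The total mass \<open>c\<close> is kept general because the bands of the cone have mass different
  from 1; an infinite right-hand side is trivial.\<close>

lemma (in finite_measure) Jensen_exp:
  assumes Z: "integrable M Z" and c: "measure M (space M) = c" "c > 0"
  shows "ennreal (c * exp ((\<integral>z. Z z \<partial>M) / c)) \<le> (\<integral>\<^sup>+z. ennreal (exp (Z z)) \<partial>M)"
proof (cases "(\<integral>\<^sup>+z. ennreal (exp (Z z)) \<partial>M) = \<infinity>")
  case False
  note [measurable] = borel_measurable_integrable[OF Z]
  have int: "integrable M (\<lambda>z. exp (Z z))"
    by (rule integrableI_nonneg) (use False in \<open>auto simp: less_top\<close>)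
  define \<mu> where "\<mu> = (\<integral>z. Z z \<partial>M) / c"
  have "c * exp \<mu> = (\<integral>z. exp \<mu> * (1 + (Z z - \<mu>)) \<partial>M)"
    using Z c by (simp add: \<mu>_def field_simps)
  also have "\<dots> \<le> (\<integral>z. exp (Z z) \<partial>M)"
  proof (rule integral_mono)
    show "exp \<mu> * (1 + (Z z - \<mu>)) \<le> exp (Z z)" for z
      using mult_left_mono[OF exp_ge_add_one_self[of "Z z - \<mu>"], of "exp \<mu>"] by (simp flip: exp_add)
  qed (use Z int in auto)
  finally have "ennreal (c * exp \<mu>) \<le> ennreal (\<integral>z. exp (Z z) \<partial>M)" by (rule ennreal_leI)
  then show ?thesis using int by (simp add: nn_integral_eq_integral \<mu>_def)
qed simp

lemma borel_measurable_descend_funpow [measurable]: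
  "descend ^^ n \<in> borel \<Otimes>\<^sub>M borel \<rightarrow>\<^sub>M borel \<Otimes>\<^sub>M borel"
  by (induction n) (simp_all, measurable)

lemma AE_cone_measure_pos:
  assumes "0 \<le> a"
  shows "AE p in cone_measure a b. 0 < fst p"
  unfolding cone_measure_def using assms by (subst AE_density) (auto simp: indicator_def)

text \<open>Substitution \<open>s = x - t * w\<close>; the half-open and open ranges differ by one
  point. It translates between relative positions and centres of intervals.\<close>

lemma nn_integral_cone_section:
  assumes [measurable]: "G \<in> borel_measurable borel" and t: "t > 0"
  shows "(\<integral>\<^sup>+w\<in>{-1..<1}. G (x - t * w) \<partial>lborel) = ennreal (1 / t) * (\<integral>\<^sup>+s\<in>{x - t<..<x + t}. G s \<partial>lborel)"
proof -
  have ind: "indicator {x - t<..<x + t} (x + (- t) * w) = (indicator {-1<..<1} w :: ennreal)" for w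
  proof -
    have "(x - t < x + (- t) * w) = (0 < t * (1 - w))" "(x + (- t) * w < x + t) = (0 < t * (w + 1))"
      by (auto simp: algebra_simps)
    then show ?thesis using t by (auto simp: indicator_def zero_less_mult_iff)
  qed
  have "(\<integral>\<^sup>+s\<in>{x - t<..<x + t}. G s \<partial>lborel) = ennreal t * (\<integral>\<^sup>+w\<in>{-1<..<1}. G (x - t * w) \<partial>lborel)"
    using t by (subst nn_integral_real_affine[where c = "- t" and t = x]) (simp_all add: ind[simplified])
  moreover have "(\<integral>\<^sup>+w\<in>{-1<..<1}. G (x - t * w) \<partial>lborel) = (\<integral>\<^sup>+w\<in>{-1..<1}. G (x - t * w) \<partial>lborel)"
    using AE_lborel_singleton[of "-1"]
    by (intro nn_integral_cong_AE) (auto elim!: eventually_mono simp: indicator_def)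
  moreover have "ennreal (1 / t) * ennreal t = 1" using t by (subst ennreal_mult'[symmetric]) auto
  ultimately show ?thesis by (simp add: mult.assoc[symmetric])
qed

text \<open>For \<open>\<bar>s - x\<bar> < t \<le> b\<close> both endpoints \<open>s + t\<close> and
  \<open>s - t\<close> lie within \<open>2 * b\<close> of \<open>x\<close>. Hence each section at
  height \<open>t\<close> is bounded by the \<open>L^1\<close> norm of \<open>f\<close> there
  divided by \<open>t^2\<close>, and \<open>t > a\<close> keeps this bounded.\<close>

lemma integrable_slope:
  assumes [measurable]: "f \<in> borel_measurable borel" and a: "0 < a"
    and f: "set_integrable lborel {x - 2 * b..x + 2 * b} f"
  shows "integrable (cone_measure a b) (slope f x)"
proof (rule integrableI_bounded)
  define C where "C = (\<integral>\<^sup>+s\<in>{x - 2 * b..x + 2 * b}. ennreal \<bar>f s\<bar> \<partial>lborel)"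
  have C: "C < \<infinity>"
  proof -
    have "C = (\<integral>\<^sup>+s. ennreal (norm (indicator {x - 2 * b..x + 2 * b} s *\<^sub>R f s)) \<partial>lborel)"
      unfolding C_def by (intro nn_integral_cong) (auto simp: indicator_def)
    then show ?thesis using f unfolding set_integrable_def integrable_iff_bounded by simp
  qed
  have sec: "(\<integral>\<^sup>+w\<in>{-1..<1}. ennreal (norm (slope f x (t, w))) \<partial>lborel) \<le> ennreal (1 / a ^ 2) * C"
    if t: "a < t" "t \<le> b" for t
  proof -
    have t0: "t > 0" using t a by simp
    \<comment> \<open>The values \<open>e = 1\<close> and \<open>e = -1\<close> treat the right and
      the left endpoint of the interval.\<close>
    have shift: "(\<integral>\<^sup>+s\<in>{x - t<..<x + t}. ennreal \<bar>f (s + e * t)\<bar> \<partial>lborel) \<le> C" if e: "e \<in> {-1, 1}" for e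
    proof -
      have "C = (\<integral>\<^sup>+s. ennreal \<bar>f (e * t + 1 * s)\<bar> * indicator {x - 2 * b..x + 2 * b} (e * t + 1 * s) \<partial>lborel)"
        unfolding C_def by (subst nn_integral_real_affine[where c = 1 and t = "e * t"]) simp_all
      also have "\<dots> \<ge> (\<integral>\<^sup>+s\<in>{x - t<..<x + t}. ennreal \<bar>f (s + e * t)\<bar> \<partial>lborel)"
        using e t t0 by (intro nn_integral_mono) (auto simp: indicator_def add.commute)
      finally show ?thesis .
    qed
    have "(\<integral>\<^sup>+s\<in>{x - t<..<x + t}. ennreal \<bar>Delta f s t\<bar> \<partial>lborel)
      \<le> (\<integral>\<^sup>+s. ennreal (1 / (2 * t)) * (ennreal \<bar>f (s + 1 * t)\<bar> * indicator {x - t<..<x + t} s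
             + ennreal \<bar>f (s + (-1) * t)\<bar> * indicator {x - t<..<x + t} s) \<partial>lborel)"
    proof (intro nn_integral_mono)
      fix s
      have "\<bar>Delta f s t\<bar> \<le> 1 / (2 * t) * (\<bar>f (s + t)\<bar> + \<bar>f (s - t)\<bar>)"
        using t0 by (simp add: Delta_def abs_divide divide_right_mono)
      then have "ennreal \<bar>Delta f s t\<bar> \<le> ennreal (1 / (2 * t) * (\<bar>f (s + t)\<bar> + \<bar>f (s - t)\<bar>))"
        by (rule ennreal_leI)
      also have "\<dots> = ennreal (1 / (2 * t)) * (ennreal \<bar>f (s + t)\<bar> + ennreal \<bar>f (s - t)\<bar>)"
        using t0 by (subst ennreal_mult') simp_all
      finally show "ennreal \<bar>Delta f s t\<bar> * indicator {x - t<..<x + t} s \<le> ennreal (1 / (2 * t)) *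
          (ennreal \<bar>f (s + 1 * t)\<bar> * indicator {x - t<..<x + t} s
             + ennreal \<bar>f (s + (-1) * t)\<bar> * indicator {x - t<..<x + t} s)"
        by (auto simp: indicator_def)
    qed
    also have "\<dots> = ennreal (1 / (2 * t)) * (\<integral>\<^sup>+s. (ennreal \<bar>f (s + 1 * t)\<bar> * indicator {x - t<..<x + t} s
             + ennreal \<bar>f (s + (-1) * t)\<bar> * indicator {x - t<..<x + t} s) \<partial>lborel)"
      by (rule nn_integral_cmult) measurable
    also have "\<dots> = ennreal (1 / (2 * t)) * ((\<integral>\<^sup>+s\<in>{x - t<..<x + t}. ennreal \<bar>f (s + 1 * t)\<bar> \<partial>lborel)
        + (\<integral>\<^sup>+s\<in>{x - t<..<x + t}. ennreal \<bar>f (s + (-1) * t)\<bar> \<partial>lborel))"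
      by (simp add: nn_integral_add)
    also have "\<dots> \<le> ennreal (1 / (2 * t)) * (C + C)"
      by (intro mult_left_mono add_mono shift) auto
    finally have inner: "(\<integral>\<^sup>+s\<in>{x - t<..<x + t}. ennreal \<bar>Delta f s t\<bar> \<partial>lborel) \<le> ennreal (1 / (2 * t)) * (C + C)" .
    have "(\<integral>\<^sup>+w\<in>{-1..<1}. ennreal (norm (slope f x (t, w))) \<partial>lborel)
       = ennreal (1 / t) * (\<integral>\<^sup>+s\<in>{x - t<..<x + t}. ennreal \<bar>Delta f s t\<bar> \<partial>lborel)"
      unfolding slope_def fst_conv snd_conv real_norm_def
      by (rule nn_integral_cone_section[OF _ t0, where G = "\<lambda>s. ennreal \<bar>Delta f s t\<bar>"]) measurable
    also have "\<dots> \<le> ennreal (1 / t) * (ennreal (1 / (2 * t)) * (C + C))"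
      by (rule mult_left_mono[OF inner]) simp
    also have "\<dots> = ennreal (1 / t ^ 2) * C"
    proof -
      have "C + C = ennreal 2 * C" by (simp add: mult_2)
      moreover have "ennreal (1 / t) * (ennreal (1 / (2 * t)) * ennreal 2) = ennreal (1 / t ^ 2)"
      proof -
        have "ennreal (1 / (2 * t)) * ennreal 2 = ennreal (1 / (2 * t) * 2)"
          using t0 by (intro ennreal_mult'[symmetric]) simp
        also have "ennreal (1 / t) * \<dots> = ennreal (1 / t * (1 / (2 * t) * 2))"
          using t0 by (intro ennreal_mult'[symmetric]) simp
        also have "1 / t * (1 / (2 * t) * 2) = 1 / t ^ 2" by (simp add: power2_eq_square)
        finally show ?thesis .
      qed
      ultimately show ?thesis by (metis mult.assoc)
    qed
    also have "\<dots> \<le> ennreal (1 / a ^ 2) * C"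
      using t a by (intro mult_right_mono ennreal_leI) (auto simp: field_simps intro!: power_mono)
    finally show ?thesis .
  qed
  have "(\<integral>\<^sup>+p. ennreal (norm (slope f x p)) \<partial>cone_measure a b)
    = (\<integral>\<^sup>+t. ennreal (indicator {a<..b} t / t) * (\<integral>\<^sup>+w\<in>{-1..<1}. ennreal (norm (slope f x (t, w))) \<partial>lborel) \<partial>lborel)"
    by (rule nn_integral_cone_measure) measurable
  also have "\<dots> \<le> (\<integral>\<^sup>+t. (ennreal (1 / a) * (ennreal (1 / a ^ 2) * C)) * indicator {a<..b} t \<partial>lborel)"
  proof (intro nn_integral_mono)
    fix t
    show "ennreal (indicator {a<..b} t / t) * (\<integral>\<^sup>+w\<in>{-1..<1}. ennreal (norm (slope f x (t, w))) \<partial>lborel)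
      \<le> (ennreal (1 / a) * (ennreal (1 / a ^ 2) * C)) * indicator {a<..b} t"
    proof (cases "t \<in> {a<..b}")
      case True
      then have "ennreal (1 / t) \<le> ennreal (1 / a)"
        using a by (intro ennreal_leI) (auto simp: field_simps)
      then have "ennreal (1 / t) * (\<integral>\<^sup>+w\<in>{-1..<1}. ennreal (norm (slope f x (t, w))) \<partial>lborel)
         \<le> ennreal (1 / a) * (ennreal (1 / a ^ 2) * C)"
        using True by (intro mult_mono sec) auto
      then show ?thesis using True by simp
    qed simp
  qed
  also have "\<dots> = ennreal (1 / a) * (ennreal (1 / a ^ 2) * C) * emeasure lborel {a<..b}"
    by (simp add: nn_integral_cmult)
  also have "\<dots> < \<infinity>"
    using C by (cases "a \<le> b") (auto simp: ennreal_mult_less_top)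
  finally show "(\<integral>\<^sup>+p. ennreal (norm (slope f x p)) \<partial>cone_measure a b) < \<infinity>" .
qed measurable

text \<open>Under \<open>s = x - t * w\<close> the measure \<open>ds dt / (2 * t^2)\<close> becomes
  half of \<open>dw dt / t\<close>. Integrability justifies Fubini, which identifies the iterated
  integral with the integral over the cone.\<close>

lemma mean_Delta_eq:
  assumes [measurable]: "f \<in> borel_measurable borel" and h: "0 < h"
    and int: "integrable (cone_measure (h / 2) h) (slope f x)"
  shows "mean_Delta f x h = (\<integral>p. slope f x p \<partial>cone_measure (h / 2) h) / 2"
proof -
  define g where "g p = indicator ({h / 2<..h} \<times> {-1..<1}) p / fst p" for p :: "real \<times> real"
  have [measurable]: "g \<in> borel_measurable (borel \<Otimes>\<^sub>M borel)" unfolding g_def[abs_def] by measurable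
  have g0: "AE p in lborel \<Otimes>\<^sub>M lborel. 0 \<le> g p" using h by (auto simp: g_def indicator_def)
  have cone_measure: "cone_measure (h / 2) h = density (lborel \<Otimes>\<^sub>M lborel) (\<lambda>p. ennreal (g p))" by (simp add: cone_measure_def g_def)
  have "integrable (lborel \<Otimes>\<^sub>M lborel) (\<lambda>p. g p *\<^sub>R slope f x p)"
    using int g0 unfolding cone_measure by (subst (asm) integrable_density) simp_all
  note fub = lborel_pair.integral_fst'[OF this]
  have inner: "(LINT s:{x - t..x + t}|lebesgue. Delta f s t / (2 * t\<^sup>2))
      = (LBINT w. indicator {-1..<1} w * slope f x (t, w)) / (2 * t)" if t: "t > 0" for t
  proof -
    have ind: "indicator {x - t..x + t} (x + (- t) * w) = (indicator {-1..1} w :: real)" for w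
    proof -
      have "(x - t \<le> x + (- t) * w) = (0 \<le> t * (1 - w))" "(x + (- t) * w \<le> x + t) = (0 \<le> t * (w + 1))"
        by (auto simp: algebra_simps)
      then show ?thesis using t by (auto simp: indicator_def zero_le_mult_iff)
    qed
    have "(LINT s:{x - t..x + t}|lebesgue. Delta f s t / (2 * t\<^sup>2))
       = (LBINT s. indicator {x - t..x + t} s *\<^sub>R (Delta f s t / (2 * t\<^sup>2)))"
      unfolding set_lebesgue_integral_def by (rule integral_completion) measurable
    also have "\<dots> = t * (LBINT w. indicator {-1..1} w *\<^sub>R (Delta f (x - t * w) t / (2 * t\<^sup>2)))"
      using t by (subst lborel_integral_real_affine[where c = "- t" and t = x]) (simp_all add: ind[simplified])
    also have "(LBINT w. indicator {-1..1} w *\<^sub>R (Delta f (x - t * w) t / (2 * t\<^sup>2)))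
       = (LBINT w. (indicator {-1..<1} w * slope f x (t, w)) / (2 * t\<^sup>2))"
    proof (rule integral_cong_AE)
      show "AE w in lborel. indicator {-1..1} w *\<^sub>R (Delta f (x - t * w) t / (2 * t\<^sup>2))
         = (indicator {-1..<1} w * slope f x (t, w)) / (2 * t\<^sup>2)"
        using AE_lborel_singleton[of 1] by eventually_elim (auto simp: indicator_def slope_def)
    qed measurable
    finally show ?thesis using t by (simp add: power2_eq_square)
  qed
  have "mean_Delta f x h = (\<integral>t. indicator {h / 2..h} t *\<^sub>R ((LBINT w. indicator {-1..<1} w * slope f x (t, w)) / (2 * t)) \<partial>lebesgue)"
    unfolding mean_Delta_def set_lebesgue_integral_def[of lebesgue "{h / 2..h}"]
  proof (intro Bochner_Integration.integral_cong refl)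
    fix t
    show "indicator {h / 2..h} t *\<^sub>R (LINT s:{x - t..x + t}|lebesgue. Delta f s t / (2 * t\<^sup>2))
      = indicator {h / 2..h} t *\<^sub>R ((LBINT w. indicator {-1..<1} w * slope f x (t, w)) / (2 * t))"
      using h inner[of t] by (cases "t \<in> {h / 2..h}") (simp_all only: indicator_simps atLeastAtMost_iff, simp_all)
  qed
  also have "\<dots> = (LBINT t. indicator {h / 2..h} t *\<^sub>R ((LBINT w. indicator {-1..<1} w * slope f x (t, w)) / (2 * t)))"
    by (rule integral_completion) measurable
  also have "\<dots> = (LBINT t. (LBINT w. g (t, w) *\<^sub>R slope f x (t, w)) / 2)"
  proof (intro integral_cong_AE)
    show "AE t in lborel. indicator {h / 2..h} t *\<^sub>R ((LBINT w. indicator {-1..<1} w * slope f x (t, w)) / (2 * t))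
       = (LBINT w. g (t, w) *\<^sub>R slope f x (t, w)) / 2"
      using AE_lborel_singleton[of "h / 2"]
    proof eventually_elim
      case (elim t)
      have "g (t, w) *\<^sub>R slope f x (t, w) = indicator {h / 2..h} t / t * (indicator {-1..<1} w * slope f x (t, w))" for w
        using elim by (auto simp: g_def indicator_def)
      then show ?case by simp
    qed
  qed measurable
  also have "\<dots> = (\<integral>p. g p *\<^sub>R slope f x p \<partial>(lborel \<Otimes>\<^sub>M lborel)) / 2"
    using fub by simp
  also have "(\<integral>p. g p *\<^sub>R slope f x p \<partial>(lborel \<Otimes>\<^sub>M lborel)) = (\<integral>p. slope f x p \<partial>cone_measure (h / 2) h)"
    unfolding cone_measure using g0 by (subst integral_density) simp_all
  finally show ?thesis .
qed

text \<open>The same substitution turns \<open>dw dt / t\<close> into \<open>ds dt / t^2\<close>.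
  Only an inequality results, since the part of the cone above height \<open>b\<close> is
  dropped.\<close>

lemma nn_integral_slope_jump_le:
  assumes [measurable]: "f \<in> borel_measurable borel" and h: "0 < h" and b: "b < h0 U x"
  shows "(\<integral>\<^sup>+p. ennreal ((slope_jump f x p)\<^sup>2) \<partial>cone_measure h b)
    \<le> (\<integral>\<^sup>+p\<in>cone U x \<inter> {p. h \<le> snd p}. ennreal ((Delta2 f (fst p) (snd p))\<^sup>2 / (snd p)\<^sup>2) \<partial>lebesgue)"
proof -
  define F :: "real \<times> real \<Rightarrow> ennreal" where "F p = ennreal ((Delta2 f (fst p) (snd p))\<^sup>2 / (snd p)\<^sup>2) *
     (if \<bar>fst p - x\<bar> < snd p \<and> h < snd p \<and> snd p \<le> b then 1 else 0)" for p
  have [measurable]: "F \<in> borel_measurable (borel \<Otimes>\<^sub>M borel)"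
    unfolding F_def[abs_def] by measurable
  have "(\<integral>\<^sup>+p. ennreal ((slope_jump f x p)\<^sup>2) \<partial>cone_measure h b)
     = (\<integral>\<^sup>+t. ennreal (indicator {h<..b} t / t) * (\<integral>\<^sup>+w\<in>{-1..<1}. ennreal ((slope_jump f x (t, w))\<^sup>2) \<partial>lborel) \<partial>lborel)"
    by (rule nn_integral_cone_measure) measurable
  also have "\<dots> = (\<integral>\<^sup>+t. \<integral>\<^sup>+s. F (s, t) \<partial>lborel \<partial>lborel)"
  proof (intro nn_integral_cong)
    fix t
    show "ennreal (indicator {h<..b} t / t) * (\<integral>\<^sup>+w\<in>{-1..<1}. ennreal ((slope_jump f x (t, w))\<^sup>2) \<partial>lborel)
      = (\<integral>\<^sup>+s. F (s, t) \<partial>lborel)"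
    proof (cases "t \<in> {h<..b}")
      case True
      then have t: "t > 0" using h by simp
      have "(\<integral>\<^sup>+w\<in>{-1..<1}. ennreal ((slope_jump f x (t, w))\<^sup>2) \<partial>lborel)
         = ennreal (1 / t) * (\<integral>\<^sup>+s\<in>{x - t<..<x + t}. ennreal ((Delta2 f s t)\<^sup>2) \<partial>lborel)"
        unfolding slope_jump_def fst_conv snd_conv
        by (rule nn_integral_cone_section[OF _ t, where G = "\<lambda>s. ennreal ((Delta2 f s t)\<^sup>2)"]) measurable
      also have "ennreal (indicator {h<..b} t / t) * \<dots>
        = ennreal (1 / t\<^sup>2) * (\<integral>\<^sup>+s\<in>{x - t<..<x + t}. ennreal ((Delta2 f s t)\<^sup>2) \<partial>lborel)"
        using True t by (simp add: mult.assoc[symmetric] power2_eq_square flip: ennreal_mult')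
      also have "\<dots> = (\<integral>\<^sup>+s. ennreal (1 / t\<^sup>2) * (ennreal ((Delta2 f s t)\<^sup>2) * indicator {x - t<..<x + t} s) \<partial>lborel)"
        by (rule nn_integral_cmult[symmetric]) measurable
      also have "\<dots> = (\<integral>\<^sup>+s. F (s, t) \<partial>lborel)"
        using True by (intro nn_integral_cong) (auto simp: F_def indicator_def abs_less_iff simp flip: ennreal_mult')
      finally show ?thesis .
    qed (auto simp: F_def)
  qed
  also have "\<dots> = (\<integral>\<^sup>+p. F p \<partial>(lborel \<Otimes>\<^sub>M lborel))"
    by (rule lborel_pair.nn_integral_snd) measurable
  also have "\<dots> = (\<integral>\<^sup>+p. F p \<partial>lebesgue)"
    by (simp add: lborel_prod nn_integral_completion)
  also have "\<dots> \<le> (\<integral>\<^sup>+p\<in>cone U x \<inter> {p. h \<le> snd p}. ennreal ((Delta2 f (fst p) (snd p))\<^sup>2 / (snd p)\<^sup>2) \<partial>lebesgue)"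
    using b by (intro nn_integral_mono) (auto simp: F_def cone_def indicator_def)
  finally show ?thesis .
qed

section \<open>The exponential estimate\<close>

text \<open>The starting values \<open>L = 0\<close> and \<open>m = 1\<close> give the Bellman bound
  \<open>2 * (1 + 2) = 6\<close>, independent of \<open>l\<close>.\<close>

definition mean_run_max :: "(real \<Rightarrow> real) \<Rightarrow> real \<Rightarrow> real \<Rightarrow> real \<Rightarrow> real \<Rightarrow> ennreal" where
  "mean_run_max f l a b x = (\<integral>\<^sup>+p. (SUP n. ennreal (run_max f l x n 0 1 p)) \<partial>cone_measure a b)"

text \<open>The \<open>k\<close>-th descent carries the band \<open>(b / 2, b]\<close> of heights to
  \<open>(b / 2^(k+1), b / 2^k]\<close>, and these bands tile \<open>(b / 2^N, b]\<close>. Thus the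
  quadratic variation, averaged over the top band, becomes a truncated square function.\<close>

lemma nn_integral_cone_measure_funpow_sum:
  assumes [measurable]: "F \<in> borel_measurable (borel \<Otimes>\<^sub>M borel)" and b: "0 \<le> b"
  shows "(\<Sum>k<N. \<integral>\<^sup>+p. F ((descend ^^ k) p) \<partial>cone_measure (b / 2) b) = (\<integral>\<^sup>+p. F p \<partial>cone_measure (b / 2 ^ N) b)"
proof (induction N)
  case 0
  have "(\<integral>\<^sup>+p. F p \<partial>cone_measure b b) = 0" by (subst nn_integral_cone_measure) simp_all
  then show ?case by simp
next
  case (Suc N)
  have "(\<integral>\<^sup>+p. F ((descend ^^ N) p) \<partial>cone_measure (b / 2) b)
     = (\<integral>\<^sup>+p. F p \<partial>distr (cone_measure (b / 2) b) (borel \<Otimes>\<^sub>M borel) (descend ^^ N))"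
    by (rule nn_integral_distr[symmetric]) measurable
  also have "\<dots> = (\<integral>\<^sup>+p. F p \<partial>cone_measure (b / 2 ^ Suc N) (b / 2 ^ N))"
    by (simp add: distr_cone_measure_descend_funpow)
  finally have "(\<integral>\<^sup>+p. F ((descend ^^ N) p) \<partial>cone_measure (b / 2) b) = (\<integral>\<^sup>+p. F p \<partial>cone_measure (b / 2 ^ Suc N) (b / 2 ^ N))" .
  moreover have "(\<integral>\<^sup>+p. F p \<partial>cone_measure (b / 2 ^ Suc N) b)
     = (\<integral>\<^sup>+p. F p \<partial>cone_measure (b / 2 ^ Suc N) (b / 2 ^ N)) + (\<integral>\<^sup>+p. F p \<partial>cone_measure (b / 2 ^ N) b)"
    using b mult_left_mono[of 1 "2 ^ N" b] by (intro nn_integral_cone_measure_add) (auto simp: field_simps)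
  ultimately show ?case by (simp only: sum.lessThan_Suc Suc add.commute)
qed

text \<open>Jensen's inequality on the top band. By invariance the mean slope after \<open>N\<close>
  descents is the mean over the band below \<open>b / 2 ^ N\<close>, and the mean quadratic
  variation is the integral bounded by \<open>q\<close>.\<close>

lemma exp_slope_le_mean_run_max:
  assumes [measurable]: "f \<in> borel_measurable borel" and b: "0 < b" "b \<le> B" "a \<le> b / 2"
    and int: "integrable (cone_measure (b / 2) b) (slope f x)"
      "integrable (cone_measure (b / 2 ^ N / 2) (b / 2 ^ N)) (slope f x)"
    and Q: "(\<integral>\<^sup>+p. ennreal ((slope_jump f x p)\<^sup>2) \<partial>cone_measure (b / 2 ^ N) b) \<le> ennreal q" and q: "0 \<le> q"
  shows "ennreal (2 * ln 2 * exp (2 / 3 *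
     (l * ((\<integral>p. slope f x p \<partial>cone_measure (b / 2 ^ N / 2) (b / 2 ^ N)) - (\<integral>p. slope f x p \<partial>cone_measure (b / 2) b))
       - l\<^sup>2 / 2 * q) / (2 * ln 2))) \<le> mean_run_max f l a B x"
proof -
  define M where "M = cone_measure (b / 2) b"
  have [measurable_cong]: "sets M = sets (borel \<Otimes>\<^sub>M borel)" by (simp add: M_def)
  \<comment> \<open>A band of ratio 2 has mass \<open>2 * (ln b - ln (b / 2))\<close>; this
    normalisation is the source of the factor \<open>ln 2\<close> in the final constant.\<close>
  have mass: "emeasure M (space M) = ennreal (2 * ln 2)"
    using b by (simp add: M_def emeasure_cone_measure ln_div)
  interpret finite_measure M by (rule finite_measureI) (simp add: mass)
  define J where "J p = (\<Sum>k<N. (slope_jump f x ((descend ^^ k) p))\<^sup>2)" for p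
  have [measurable]: "J \<in> borel_measurable M" unfolding J_def[abs_def] by measurable
  have "(\<integral>\<^sup>+p. ennreal (J p) \<partial>M) = (\<Sum>k<N. \<integral>\<^sup>+p. ennreal ((slope_jump f x ((descend ^^ k) p))\<^sup>2) \<partial>M)"
    unfolding J_def by (subst sum_ennreal[symmetric], simp) (rule nn_integral_sum, measurable)
  also have "\<dots> = (\<integral>\<^sup>+p. ennreal ((slope_jump f x p)\<^sup>2) \<partial>cone_measure (b / 2 ^ N) b)"
    unfolding M_def using b by (intro nn_integral_cone_measure_funpow_sum) auto
  finally have nnJ: "(\<integral>\<^sup>+p. ennreal (J p) \<partial>M) \<le> ennreal q" using Q by simp
  have J0: "0 \<le> J p" for p by (auto simp: J_def intro: sum_nonneg)
  have intJ: "integrable M J"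
    using nnJ J0 by (intro integrableI_nonneg) (auto simp: less_top[symmetric] top_unique)
  have leJ: "(\<integral>p. J p \<partial>M) \<le> q"
    using nnJ intJ J0 q by (simp add: nn_integral_eq_integral)
  have distr: "cone_measure (b / 2 ^ N / 2) (b / 2 ^ N) = distr M (borel \<Otimes>\<^sub>M borel) (descend ^^ N)"
    by (simp add: M_def distr_cone_measure_descend_funpow field_simps)
  have intS: "integrable M (\<lambda>p. slope f x ((descend ^^ N) p))"
    using int(2) unfolding distr by (subst (asm) integrable_distr_eq) auto
  have eqS: "(\<integral>p. slope f x p \<partial>cone_measure (b / 2 ^ N / 2) (b / 2 ^ N)) = (\<integral>p. slope f x ((descend ^^ N) p) \<partial>M)"
    unfolding distr by (rule integral_distr) measurable
  note int0 = int(1)[folded M_def]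
  define Z where "Z p = 2 / 3 * (l * (slope f x ((descend ^^ N) p) - slope f x p) - l\<^sup>2 / 2 * J p)" for p
  have intZ: "integrable M Z" unfolding Z_def[abs_def] using intS int0 intJ by simp
  have "(\<integral>p. Z p \<partial>M) = 2 / 3 * (l * ((\<integral>p. slope f x ((descend ^^ N) p) \<partial>M) - (\<integral>p. slope f x p \<partial>M))
       - l\<^sup>2 / 2 * (\<integral>p. J p \<partial>M))"
    unfolding Z_def using intS int0 intJ by simp
  also have "\<dots> \<ge> 2 / 3 * (l * ((\<integral>p. slope f x ((descend ^^ N) p) \<partial>M) - (\<integral>p. slope f x p \<partial>M)) - l\<^sup>2 / 2 * q)"
    using mult_left_mono[OF leJ, of "l\<^sup>2 / 2"] by simp
  finally have leZ: "2 / 3 * (l * ((\<integral>p. slope f x ((descend ^^ N) p) \<partial>M) - (\<integral>p. slope f x p \<partial>M)) - l\<^sup>2 / 2 * q)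
     \<le> (\<integral>p. Z p \<partial>M)" .
  have "ennreal (2 * ln 2 * exp (2 / 3 *
     (l * ((\<integral>p. slope f x ((descend ^^ N) p) \<partial>M) - (\<integral>p. slope f x p \<partial>M)) - l\<^sup>2 / 2 * q) / (2 * ln 2)))
     \<le> ennreal (2 * ln 2 * exp ((\<integral>p. Z p \<partial>M) / (2 * ln 2)))"
    by (intro ennreal_leI mult_left_mono iffD2[OF exp_le_cancel_iff] divide_right_mono leZ) auto
  also have "\<dots> \<le> (\<integral>\<^sup>+p. ennreal (exp (Z p)) \<partial>M)"
    by (rule Jensen_exp[OF intZ]) (auto simp: measure_def mass)
  also have "\<dots> \<le> (\<integral>\<^sup>+p. (SUP n. ennreal (run_max f l x n 0 1 p)) \<partial>M)"
  proof (rule nn_integral_mono_AE)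
    have "AE p in M. 0 < fst p" unfolding M_def using b by (intro AE_cone_measure_pos) simp
    then show "AE p in M. ennreal (exp (Z p)) \<le> (SUP n. ennreal (run_max f l x n 0 1 p))"
    proof eventually_elim
      case (elim p)
      have "exp (Z p) \<le> run_max f l x N 0 1 p"
        using run_max_ge[OF elim, of 0 l f x N 1] by (simp add: Z_def J_def)
      then show ?case by (intro SUP_upper2[of N] ennreal_leI) auto
    qed
  qed
  also have "\<dots> \<le> mean_run_max f l a B x"
    unfolding mean_run_max_def M_def using b by (intro nn_integral_cone_measure_mono) auto
  finally show ?thesis unfolding eqS M_def .
qed

text \<open>At a fixed height \<open>t\<close>, Fubini and the change of variable
  \<open>x = s + t * w\<close> replace the average over intervals around a point by the average over
  points of a fixed interval, where \<open>nn_integral_run_max\<close> applies.\<close>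

lemma nn_integral_mean_run_max_le:
  assumes [measurable]: "f \<in> borel_measurable borel" and a: "0 \<le> a" and b: "b \<le> 1" and R: "R \<ge> 0"
  shows "(\<integral>\<^sup>+x\<in>{-R..R}. mean_run_max f l a b x \<partial>lborel) \<le> ennreal (6 * (R + 1)) * emeasure (cone_measure a b) UNIV"
proof -
  define S where "S x p = (SUP n. ennreal (run_max f l x n 0 1 p))" for x p
  have [measurable]: "(\<lambda>z. S (X z) (P z)) \<in> borel_measurable M'"
    if [measurable]: "X \<in> borel_measurable M'" "P \<in> M' \<rightarrow>\<^sub>M borel \<Otimes>\<^sub>M borel" for X P and M' :: "'z measure"
    unfolding S_def by measurable
  have bound: "(\<integral>\<^sup>+w\<in>{-1..<1}. S (s + t * w) (t, w) \<partial>lborel) \<le> 6" for s t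
  proof -
    have "(\<integral>\<^sup>+w\<in>{-1..<1}. S (s + t * w) (t, w) \<partial>lborel)
       = (\<integral>\<^sup>+w. (SUP n. ennreal (run_max f l (s + t * w) n 0 1 (t, w)) * indicator {-1..<1} w) \<partial>lborel)"
      unfolding S_def by (simp add: SUP_mult_right_ennreal)
    also have "\<dots> = (SUP n. \<integral>\<^sup>+w\<in>{-1..<1}. ennreal (run_max f l (s + t * w) n 0 1 (t, w)) \<partial>lborel)"
    proof (rule nn_integral_monotone_convergence_SUP)
      show "incseq (\<lambda>n w. ennreal (run_max f l (s + t * w) n 0 1 (t, w)) * indicator {-1..<1} w)"
        by (intro incseq_SucI le_funI mult_right_mono ennreal_leI run_max_mono) simp
    qed measurable
    also have "\<dots> \<le> 6"
      using nn_integral_run_max[OF assms(1), of 1 l s t _ 0] by (intro SUP_least) simp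
    finally show ?thesis .
  qed
  define k where "k t = ennreal (indicator {a<..b} t / t)" for t
  have [measurable]: "k \<in> borel_measurable borel" unfolding k_def[abs_def] by measurable
  have "(\<integral>\<^sup>+t. k t \<partial>lborel) * 2 = (\<integral>\<^sup>+t. k t * 2 \<partial>lborel)"
    by (rule nn_integral_multc[symmetric]) measurable
  also have "\<dots> = (\<integral>\<^sup>+p. 1 \<partial>cone_measure a b)"
    by (subst nn_integral_cone_measure) (simp_all add: k_def)
  finally have k2: "(\<integral>\<^sup>+t. k t \<partial>lborel) * 2 = emeasure (cone_measure a b) UNIV" by simp
  have "(\<integral>\<^sup>+x\<in>{-R..R}. mean_run_max f l a b x \<partial>lborel)
      = (\<integral>\<^sup>+x. (\<integral>\<^sup>+t. k t * (\<integral>\<^sup>+w\<in>{-1..<1}. S x (t, w) \<partial>lborel) \<partial>lborel) * indicator {-R..R} x \<partial>lborel)"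
    unfolding mean_run_max_def k_def S_def[symmetric] by (subst nn_integral_cone_measure) simp_all
  also have "\<dots> = (\<integral>\<^sup>+x. (\<integral>\<^sup>+t. k t * (\<integral>\<^sup>+w\<in>{-1..<1}. S x (t, w) * indicator {-R..R} x \<partial>lborel) \<partial>lborel) \<partial>lborel)"
    by (intro nn_integral_cong) (auto simp: indicator_def)
  also have "\<dots> = (\<integral>\<^sup>+t. (\<integral>\<^sup>+x. k t * (\<integral>\<^sup>+w\<in>{-1..<1}. S x (t, w) * indicator {-R..R} x \<partial>lborel) \<partial>lborel) \<partial>lborel)"
    by (rule lborel_pair.Fubini'[symmetric]) measurable
  also have "\<dots> = (\<integral>\<^sup>+t. k t * (\<integral>\<^sup>+x. (\<integral>\<^sup>+w\<in>{-1..<1}. S x (t, w) * indicator {-R..R} x \<partial>lborel) \<partial>lborel) \<partial>lborel)"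
    by (intro nn_integral_cong nn_integral_cmult) measurable
  also have "\<dots> \<le> (\<integral>\<^sup>+t. k t * ennreal (12 * (R + 1)) \<partial>lborel)"
  proof (intro nn_integral_mono)
    fix t
    show "k t * (\<integral>\<^sup>+x. (\<integral>\<^sup>+w\<in>{-1..<1}. S x (t, w) * indicator {-R..R} x \<partial>lborel) \<partial>lborel) \<le> k t * ennreal (12 * (R + 1))"
    proof (cases "t \<in> {a<..b}")
      case True
      then have t: "0 < t" "t \<le> 1" using a b by auto
      have "(\<integral>\<^sup>+x. (\<integral>\<^sup>+w\<in>{-1..<1}. S x (t, w) * indicator {-R..R} x \<partial>lborel) \<partial>lborel)
         = (\<integral>\<^sup>+w. (\<integral>\<^sup>+x. S x (t, w) * indicator {-R..R} x * indicator {-1..<1} w \<partial>lborel) \<partial>lborel)"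
        by (rule lborel_pair.Fubini'[symmetric]) measurable
      also have "\<dots> = (\<integral>\<^sup>+w. (\<integral>\<^sup>+s. S (t * w + 1 * s) (t, w) * indicator {-R..R} (t * w + 1 * s) * indicator {-1..<1} w \<partial>lborel) \<partial>lborel)"
      proof (rule nn_integral_cong)
        fix w
        show "(\<integral>\<^sup>+x. S x (t, w) * indicator {-R..R} x * indicator {-1..<1} w \<partial>lborel)
           = (\<integral>\<^sup>+s. S (t * w + 1 * s) (t, w) * indicator {-R..R} (t * w + 1 * s) * indicator {-1..<1} w \<partial>lborel)"
          by (subst nn_integral_real_affine[where c = 1 and t = "t * w"]) simp_all
      qed
      \<comment> \<open>From \<open>\<bar>x\<bar> \<le> R\<close> and
        \<open>\<bar>t * w\<bar> \<le> 1\<close> the centre satisfies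
        \<open>\<bar>s\<bar> \<le> R + 1\<close>; this is where \<open>b \<le> 1\<close>
        enters.\<close>
      also have "\<dots> \<le> (\<integral>\<^sup>+w. (\<integral>\<^sup>+s. S (s + t * w) (t, w) * indicator {-1..<1} w * indicator {-(R + 1)..R + 1} s \<partial>lborel) \<partial>lborel)"
      proof (intro nn_integral_mono)
        fix w s
        show "S (t * w + 1 * s) (t, w) * indicator {-R..R} (t * w + 1 * s) * indicator {-1..<1} w
          \<le> S (s + t * w) (t, w) * indicator {-1..<1} w * indicator {-(R + 1)..R + 1} s"
        proof (cases "w \<in> {-1..<1} \<and> t * w + s \<in> {-R..R}")
          case True
          then have "\<bar>t * w\<bar> \<le> 1 * 1" using t unfolding abs_mult by (intro mult_mono) auto
          then have "s \<in> {-(R + 1)..R + 1}" using True by auto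
          then show ?thesis using True by (simp add: add.commute)
        qed (auto simp: indicator_def)
      qed
      also have "\<dots> = (\<integral>\<^sup>+s. (\<integral>\<^sup>+w. S (s + t * w) (t, w) * indicator {-1..<1} w * indicator {-(R + 1)..R + 1} s \<partial>lborel) \<partial>lborel)"
        by (rule lborel_pair.Fubini'[symmetric]) measurable
      also have "\<dots> = (\<integral>\<^sup>+s. (\<integral>\<^sup>+w\<in>{-1..<1}. S (s + t * w) (t, w) \<partial>lborel) * indicator {-(R + 1)..R + 1} s \<partial>lborel)"
        by (intro nn_integral_cong nn_integral_multc) measurable
      also have "\<dots> \<le> (\<integral>\<^sup>+s. 6 * indicator {-(R + 1)..R + 1} s \<partial>lborel)"
        by (intro nn_integral_mono mult_right_mono bound) simp
      also have "\<dots> = 6 * ennreal (2 * (R + 1))"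
        using R by (simp add: nn_integral_cmult)
      also have "\<dots> = ennreal (12 * (R + 1))"
        by (simp flip: ennreal_numeral ennreal_mult' add: algebra_simps)
      finally show ?thesis by (rule mult_left_mono) simp
    qed (simp add: k_def)
  qed
  also have "\<dots> = (\<integral>\<^sup>+t. k t \<partial>lborel) * ennreal (12 * (R + 1))"
    by (rule nn_integral_multc) measurable
  \<comment> \<open>A factor 2 of the constant 12 goes back into the mass of the cone measure, which
    is twice the integral of \<open>k\<close>.\<close>
  also have "\<dots> = ennreal (6 * (R + 1)) * ((\<integral>\<^sup>+t. k t \<partial>lborel) * 2)"
  proof -
    have "ennreal (12 * (R + 1)) = ennreal (6 * (R + 1)) * ennreal 2"
      using R by (subst ennreal_mult'[symmetric]) (auto simp: algebra_simps)
    then show ?thesis by (simp add: mult_ac)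
  qed
  also have "\<dots> = ennreal (6 * (R + 1)) * emeasure (cone_measure a b) UNIV" by (simp only: k2)
  finally show ?thesis .
qed

section \<open>Choice of the exponential parameter\<close>

lemma measurable_mean_run_max:
  assumes [measurable]: "f \<in> borel_measurable borel"
  shows "mean_run_max f l a b \<in> borel_measurable borel"
proof -
  have "mean_run_max f l a b = (\<lambda>x. \<integral>\<^sup>+t. ennreal (indicator {a<..b} t / t) *
      (\<integral>\<^sup>+w\<in>{-1..<1}. (SUP n. ennreal (run_max f l x n 0 1 (t, w))) \<partial>lborel) \<partial>lborel)"
    unfolding mean_run_max_def[abs_def] by (subst nn_integral_cone_measure) simp_all
  also have "\<dots> \<in> borel_measurable borel" by measurable
  finally show ?thesis .
qed

text \<open>Markov's inequality on each \<open>[-R, R]\<close> and Borel-Cantelli. The integral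
  bound does not depend on \<open>l\<close>, so the parameters \<open>l k\<close> are arbitrary, and
  \<open>9 / 8 > 1\<close> makes the weights summable.\<close>

lemma AE_eventually_mean_run_max_less:
  assumes f [measurable]: "f \<in> borel_measurable borel" and a: "0 < a" and b: "a \<le> b" "b \<le> 1"
  shows "AE x in lborel. \<forall>\<^sub>F k in sequentially. mean_run_max f (l k) a b x < ennreal (real (Suc k) powr (9 / 8))"
proof -
  note [measurable] = measurable_mean_run_max[OF f]
  have "AE x in lborel. \<forall>R. \<forall>\<^sub>F k in sequentially. x \<in> space lborel -
      {x \<in> {- real R..real R}. 1 \<le> ennreal (real (Suc k) powr - (9 / 8)) * mean_run_max f (l k) a b x}"
  proof (subst AE_all_countable, intro allI)
    fix R :: nat
    define c where "c k = real (Suc k) powr - (9 / 8)" for k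
    define A where "A k = {x \<in> {- real R..real R}. 1 \<le> ennreal (c k) * mean_run_max f (l k) a b x}" for k
    define D where "D = 6 * (real R + 1) * (2 * (ln b - ln a))"
    have D: "D \<ge> 0" using a b by (simp add: D_def)
    have le: "emeasure lborel (A k) \<le> ennreal (c k * D)" for k
    proof -
      have "emeasure lborel (A k) \<le> ennreal (c k) * (\<integral>\<^sup>+x\<in>{- real R..real R}. mean_run_max f (l k) a b x \<partial>lborel)"
        unfolding A_def by (rule nn_integral_Markov_inequality) measurable
      also have "\<dots> \<le> ennreal (c k) * (ennreal (6 * (real R + 1)) * ennreal (2 * (ln b - ln a)))"
        using nn_integral_mean_run_max_le[OF f, of a b "real R" "l k"] a b
        by (intro mult_left_mono) (auto simp: emeasure_cone_measure)
      also have "\<dots> = ennreal (c k * D)"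
      proof -
        have "0 \<le> c k" "0 \<le> 6 * (real R + 1)" by (simp_all add: c_def)
        then show ?thesis unfolding D_def by (simp only: ennreal_mult' mult.assoc)
      qed
      finally show ?thesis .
    qed
    have "AE x in lborel. \<forall>\<^sub>F k in sequentially. x \<in> space lborel - A k"
    proof (rule borel_cantelli_AE1)
      show "A k \<in> sets lborel" for k unfolding A_def by measurable
      show "emeasure lborel (A k) < \<infinity>" for k using le[of k] by (simp add: le_less_trans)
      have "summable (\<lambda>k. real k powr - (9 / 8))" by (simp add: summable_real_powr_iff)
      then have "summable (\<lambda>k. c k * D)"
        unfolding c_def by (intro summable_mult2) (subst summable_Suc_iff)
      then show "summable (\<lambda>k. measure lborel (A k))"
      proof (rule summable_comparison_test')
        show "norm (measure lborel (A k)) \<le> c k * D" for k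
          using le[of k] D by (auto simp: measure_def c_def intro!: enn2real_leI)
      qed
    qed
    then show "AE x in lborel. \<forall>\<^sub>F k in sequentially. x \<in> space lborel -
      {x \<in> {- real R..real R}. 1 \<le> ennreal (real (Suc k) powr - (9 / 8)) * mean_run_max f (l k) a b x}"
      by (simp only: A_def c_def)
  qed
  then show ?thesis
  proof eventually_elim
    case (elim x)
    obtain R :: nat where "\<bar>x\<bar> \<le> real R" using real_arch_simple by blast
    then have R: "x \<in> {- real R..real R}" by auto
    from elim have "\<forall>\<^sub>F k in sequentially. x \<in> space lborel -
      {x \<in> {- real R..real R}. 1 \<le> ennreal (real (Suc k) powr - (9 / 8)) * mean_run_max f (l k) a b x}" by blast
    then show ?case
    proof eventually_elim
      case (elim k)
      define P where "P = mean_run_max f (l k) a b x"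
      define y where "y = real (Suc k) powr (9 / 8)"
      have y: "y > 0" by (simp add: y_def)
      have lt: "ennreal (1 / y) * P < 1"
        using elim R by (auto simp: P_def y_def powr_minus_divide not_le)
      have "ennreal y * (ennreal (1 / y) * P) < ennreal y * 1"
        using lt y by (intro ennreal_mult_strict_left_mono) auto
      moreover have "ennreal y * (ennreal (1 / y) * P) = P"
        using y by (simp add: mult.assoc[symmetric] flip: ennreal_mult')
      ultimately show ?case by (simp add: P_def y_def)
    qed
  qed
qed

text \<open>By convexity \<open>v + 1 / v\<close> is largest at the ends of
  \<open>[20/33, 33/20]\<close>, where it equals \<open>33/20 + 20/33 < 2.2561\<close>.\<close>

lemma recip_sum_bound:
  fixes v :: real
  assumes "v \<le> 33 / 20" "1 \<le> v * (33 / 20)"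
  shows "v + 2 + 1 / v \<le> 4.2561" 
proof -
  have v: "v > 0" using assms(2) by linarith
  have "(v - 33 / 20) * (v * (33 / 20) - 1) \<le> 0"
    using assms by (intro mult_nonpos_nonneg) auto
  moreover have "(v - 33 / 20) * (v * (33 / 20) - 1) = 33 / 20 * (v * v + 1 - (33 / 20 + 20 / 33) * v)"
    by (simp add: field_simps)
  ultimately have "33 / 20 * (v * v + 1 - (33 / 20 + 20 / 33) * v) \<le> 0" by (simp only:)
  then have "v * v + 1 \<le> (33 / 20 + 20 / 33) * v" by (simp add: mult_le_0_iff)
  then have "(v * v + 1) / v \<le> 33 / 20 + 20 / 33" using v by (simp add: field_simps)
  moreover have "(v * v + 1) / v = v + 1 / v" using v by (simp add: field_simps)
  ultimately show ?thesis by simp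
qed

text \<open>
  \<open>tilt k\<close> minimises \<open>p / \<lambda> + \<lambda> q / 4\<close> over \<open>\<lambda>\<close> for \<open>p = 27/16 ln 2 ln (k + 1)\<close> and \<open>q = exp (k + 3/2)\<close>,
  the centre (in logarithmic scale) of the range \<open>exp (k + 1) \<le> q < exp (k + 2)\<close> where it is used.
  The factor \<open>27/16\<close> is \<open>3/2 * 9/8\<close>, from the power \<open>2/3\<close> and the summable weights \<open>k powr - 9/8\<close>.
\<close>

definition tilt :: "nat \<Rightarrow> real" where
  "tilt k = 2 * sqrt (27 / 16 * ln 2 * ln (real (Suc k)) / exp (real k + 3 / 2))"

lemma tilt_pos: "k \<ge> 1 \<Longrightarrow> tilt k > 0"
  by (simp add: tilt_def)

text \<open>The constant is chosen so that its square, \<open>2.7225\<close>, just exceeds the bound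
  \<open>2.72\<close> for \<open>exp 1\<close>.\<close>

lemma exp_half_bound: "exp (1 / 2 :: real) \<le> 33 / 20"
proof -
  have "exp (1 / 2 :: real) ^ 2 = exp 1" by (simp flip: exp_of_nat_mult)
  also have "\<dots> \<le> (33 / 20) ^ 2" using e_less_272 by (simp add: power2_eq_square)
  finally show ?thesis by (rule power2_le_imp_le) simp
qed

text \<open>The deterministic part of the argument: among the inequalities for all
  \<open>k \<ge> K\<close>, the one whose tilt is adapted to the size of \<open>q\<close> is
  used.\<close>

lemma iterated_log_optimization:
  fixes B :: real
  shows "\<forall>\<^sub>F q in at_top. \<forall>m. (\<forall>k\<ge>K. tilt k * (2 * m - B) \<le>
        27 / 8 * ln 2 * ln (real (Suc k)) + (tilt k)\<^sup>2 * q / 2) \<longrightarrow>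
      m \<le> sqrt (2 * ln 2) * sqrt (q * ln (ln q))"
proof -
  \<comment> \<open>The optimisation reaches the constant \<open>9/5\<close> instead of
    \<open>2\<close>; the gap \<open>\<epsilon>\<close> absorbs the fixed error \<open>B / 2\<close>
    once \<open>q\<close> is large.\<close>
  define \<epsilon> where "\<epsilon> = sqrt (2 * ln 2) - sqrt (9 / 5 * ln 2 :: real)"
  have \<epsilon>: "\<epsilon> > 0" by (simp add: \<epsilon>_def)
  have "filterlim (\<lambda>q::real. sqrt (q * ln (ln q))) at_top at_top" by real_asymp
  then have "\<forall>\<^sub>F q in at_top. B / 2 / \<epsilon> \<le> sqrt (q * ln (ln q))" by (auto simp: filterlim_at_top)
  moreover have "\<forall>\<^sub>F q :: real in at_top. exp (real K + 2) \<le> q" by (rule eventually_ge_at_top)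
  ultimately show ?thesis
  proof eventually_elim
    case (elim q)
    show ?case
    proof (intro allI impI)
      fix m assume *: "\<forall>k\<ge>K. tilt k * (2 * m - B) \<le> 27 / 8 * ln 2 * ln (real (Suc k)) + (tilt k)\<^sup>2 * q / 2"
      have q: "q > 0" using elim(2) exp_gt_zero[of "real K + 2"] by linarith
      have lnq: "ln q \<ge> real K + 2" using elim(2) q by (simp add: ln_ge_iff)
      \<comment> \<open>This places \<open>q\<close> in the block
        \<open>exp (k + 1) \<le> q < exp (k + 2)\<close>. Since \<open>ln q \<ge> K + 2\<close>,
        also \<open>k \<ge> 1\<close>, which excludes the vanishing value
        \<open>tilt 0\<close>.\<close>
      define k where "k = nat \<lfloor>ln q\<rfloor> - 1"
      have k1: "real k + 1 = of_int \<lfloor>ln q\<rfloor>" using lnq unfolding k_def by linarith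
      have k2: "real k + 1 \<le> ln q" "ln q < real k + 2" using k1 by linarith+
      have kK: "k \<ge> K" "k \<ge> 1" using k2 lnq by linarith+
      define p where "p = 27 / 16 * ln 2 * ln (real (Suc k))"
      have p: "p > 0" using kK by (simp add: p_def)
      define E where "E = exp (real k + 3 / 2)"
      have E: "E > 0" by (simp add: E_def)
      define l where "l = tilt k"
      have l: "l = 2 * sqrt (p / E)" "l > 0" using kK tilt_pos by (auto simp: l_def tilt_def p_def E_def)
      have "l * (2 * m - B) \<le> 2 * p + l\<^sup>2 * q / 2"
        using * kK by (auto simp: l_def p_def)
      then have "2 * m - B \<le> (2 * p + l\<^sup>2 * q / 2) / l"
        using l(2) by (simp add: pos_le_divide_eq mult.commute)
      moreover have "(2 * p + l\<^sup>2 * q / 2) / l = 2 * ((p + l\<^sup>2 * q / 4) / l)" using l(2) by (simp add: field_simps)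
      ultimately have m1: "m - B / 2 \<le> (p + l\<^sup>2 * q / 4) / l" by linarith
      \<comment> \<open>With this \<open>l\<close> the square below equals \<open>p * q\<close> when
        \<open>E = q\<close>; the bracket measures the loss from fixing one tilt for a whole
        block.\<close>
      have "l\<^sup>2 = 4 * (p / E)" using p E l by (simp add: power_mult_distrib)
      then have sq: "((p + l\<^sup>2 * q / 4) / l)\<^sup>2 = p * q * (E / q + 2 + 1 / (E / q)) / 4"
        unfolding power_divide \<open>l\<^sup>2 = 4 * (p / E)\<close> using p E q by (simp add: field_simps power2_eq_square)
      have Eq: "E / q = exp (real k + 3 / 2 - ln q)" using q by (simp add: E_def exp_diff)
      also have "\<dots> \<le> exp (1 / 2)" using k2 by simp
      finally have v1: "E / q \<le> 33 / 20" using exp_half_bound by linarith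
      have "1 \<le> exp (real k + 3 / 2 - ln q + 1 / 2)" using k2 by simp
      also have "\<dots> = E / q * exp (1 / 2)" by (simp only: Eq exp_add)
      also have "\<dots> \<le> E / q * (33 / 20)" using E q exp_half_bound by (intro mult_left_mono) auto
      finally have v2: "1 \<le> E / q * (33 / 20)" .
      have "p * q * (E / q + 2 + 1 / (E / q)) / 4 \<le> p * q * 4.2561 / 4"
        using recip_sum_bound[OF v1 v2] p q by (intro divide_right_mono mult_left_mono) auto
      \<comment> \<open>Here \<open>27/16 * 4.2561 / 4 < 9/5\<close>.\<close>
      also have "\<dots> \<le> (9 / 5 * ln 2) * (q * ln (real (Suc k)))"
        using q by (simp add: p_def)
      also have "\<dots> \<le> (9 / 5 * ln 2) * (q * ln (ln q))"
      proof -
        have "ln (real (Suc k)) \<le> ln (ln q)" using k2 by (subst ln_le_cancel_iff) auto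
        then show ?thesis using q by (intro mult_left_mono) auto
      qed
      finally have "(p + l\<^sup>2 * q / 4) / l \<le> sqrt ((9 / 5 * ln 2) * (q * ln (ln q)))"
        unfolding sq[symmetric] by (rule real_le_rsqrt)
      then have "m \<le> B / 2 + sqrt (9 / 5 * ln 2) * sqrt (q * ln (ln q))"
        using m1 unfolding real_sqrt_mult[of "9 / 5 * ln 2"] by linarith
      also have "B / 2 \<le> \<epsilon> * sqrt (q * ln (ln q))"
        using elim(1) \<epsilon> by (simp add: field_simps)
      finally show "m \<le> sqrt (2 * ln 2) * sqrt (q * ln (ln q))"
        by (simp add: \<epsilon>_def algebra_simps)
    qed
  qed
qed

section \<open>Replacing the function by a Borel function\<close>

text \<open>The factor 2 is what the points \<open>s - t\<close>, \<open>s\<close>,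
  \<open>s + t\<close> with \<open>\<bar>s - x\<bar> \<le> t < h0 U x\<close> require.\<close>

lemma in_if_near_h0:
  assumes "\<bar>y - x\<bar> < 2 * h0 U x"
  shows "y \<in> U"
proof (rule ccontr)
  assume y: "y \<notin> U"
  then have "h0 U x \<le> infdist x (- U) / 2" by (auto simp: h0_def)
  also have "\<dots> \<le> dist x y / 2" using y by (intro divide_right_mono infdist_le) auto
  finally show False using assms by (simp add: dist_real_def)
qed

lemma h0_pos:
  assumes "open U" "x \<in> U"
  shows "h0 U x > 0"
  using infdist_pos_not_in_closed[of "- U" x] assms by (auto simp: h0_def)

text \<open>Borel measurability is stable under the compositions that occur along the descent,
  Lebesgue measurability in general is not.\<close>

lemma Borel_version:
  fixes f :: "real \<Rightarrow> real"
  assumes "open U" and f: "f \<in> borel_measurable (lebesgue_on U)"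
  obtains g N where "g \<in> borel_measurable borel" "N \<in> null_sets lborel"
    "\<And>y. y \<in> U \<Longrightarrow> y \<notin> N \<Longrightarrow> f y = g y"
proof -
  have "U \<in> sets lebesgue" using assms(1) by auto
  then have "(\<lambda>y. indicator U y *\<^sub>R f y) \<in> borel_measurable lebesgue"
    using f by (subst (asm) borel_measurable_restrict_space_iff) auto
  then obtain g where g: "g \<in> borel_measurable lborel" "AE y in lborel. indicator U y *\<^sub>R f y = g y"
    using completion_ex_borel_measurable_real by blast
  from AE_E[OF g(2)] obtain N where sub: "{y \<in> space lborel. indicator U y *\<^sub>R f y \<noteq> g y} \<subseteq> N"
    "emeasure lborel N = 0" "N \<in> sets lborel" .
  with g(1) show ?thesis
  proof (intro that[of g N])
    fix y assume "y \<in> U" "y \<notin> N"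
    then have "y \<notin> {y \<in> space lborel. indicator U y *\<^sub>R f y \<noteq> g y}" using sub by blast
    then show "f y = g y" using \<open>y \<in> U\<close> by simp
  qed (auto simp: null_sets_def)
qed

lemma AE_affine_notin_null_sets:
  fixes N :: "real set"
  assumes N: "N \<in> null_sets lborel" and "c \<noteq> 0"
  shows "AE t in lborel. s + c * t \<notin> N"
proof (rule AE_borel_affine[OF assms(2)])
  show "Measurable.pred borel (\<lambda>x. x \<notin> N)" using null_setsD2[OF N] by simp
  show "AE x in lborel. x \<notin> N" by (rule AE_not_in[OF N])
qed

text \<open>For fixed \<open>s\<close> outside \<open>N\<close>, the other two conditions are affine
  and nonconstant in \<open>t\<close>, so almost every \<open>t\<close> satisfies them; Fubini does
  the rest.\<close>

lemma AE_differences_notin_null_sets: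
  fixes N :: "real set"
  assumes N: "N \<in> null_sets lborel"
  shows "AE p in lebesgue. fst p \<notin> N \<and> fst p + snd p \<notin> N \<and> fst p - snd p \<notin> N"
proof -
  have [measurable]: "N \<in> sets borel" using null_setsD2[OF N] by simp
  have "AE p in lborel \<Otimes>\<^sub>M lborel. fst p \<notin> N \<and> fst p + snd p \<notin> N \<and> fst p - snd p \<notin> N"
  proof (rule lborel_pair.AE_pair_measure)
    show "{p \<in> space (lborel \<Otimes>\<^sub>M lborel). fst p \<notin> N \<and> fst p + snd p \<notin> N \<and> fst p - snd p \<notin> N}
        \<in> sets (lborel \<Otimes>\<^sub>M lborel)" by measurable
    show "AE s in lborel. AE t in lborel. fst (s, t) \<notin> N \<and> fst (s, t) + snd (s, t) \<notin> N \<and> fst (s, t) - snd (s, t) \<notin> N"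
      using AE_not_in[OF N]
    proof eventually_elim
      case (elim s)
      have "AE t in lborel. s + 1 * t \<notin> N" "AE t in lborel. s + (-1) * t \<notin> N"
        by (rule AE_affine_notin_null_sets[OF N], simp)+
      then show ?case by eventually_elim (use elim in simp)
    qed
  qed
  then show ?thesis by (intro AE_completion) (simp only: lborel_prod)
qed

section \<open>Transfer between a function and its Borel version\<close>

context
  fixes U N :: "real set" and f g :: "real \<Rightarrow> real"
  assumes N: "N \<in> null_sets lborel" and eq: "\<And>y. y \<in> U \<Longrightarrow> y \<notin> N \<Longrightarrow> f y = g y"
begin

lemma nn_integral_Delta2_cong:
  assumes "C \<subseteq> cone U x"
  shows "(\<integral>\<^sup>+p\<in>C. ennreal ((Delta2 f (fst p) (snd p))\<^sup>2 / (snd p)\<^sup>2) \<partial>lebesgue)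
    = (\<integral>\<^sup>+p\<in>C. ennreal ((Delta2 g (fst p) (snd p))\<^sup>2 / (snd p)\<^sup>2) \<partial>lebesgue)"
proof (rule nn_integral_cong_AE)
  show "AE p in lebesgue. ennreal ((Delta2 f (fst p) (snd p))\<^sup>2 / (snd p)\<^sup>2) * indicator C p
      = ennreal ((Delta2 g (fst p) (snd p))\<^sup>2 / (snd p)\<^sup>2) * indicator C p"
    using AE_differences_notin_null_sets[OF N]
  proof eventually_elim
    case (elim p)
    show ?case
    proof (cases "p \<in> C")
      case True
      then have "\<bar>fst p - x\<bar> < snd p" "snd p < h0 U x" using assms by (auto simp: cone_def)
      then have "fst p \<in> U" "fst p + snd p \<in> U" "fst p - snd p \<in> U"
        by (intro in_if_near_h0[of _ x]; linarith)+
      then show ?thesis using elim by (simp add: Delta2_def eq)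
    qed simp
  qed
qed

lemma A_sq_cong: "A_sq U f x = A_sq U g x"
  and A_sq_trunc_cong: "A_sq_trunc U f x h = A_sq_trunc U g x h"
  unfolding A_sq_def A_sq_trunc_def by (subst nn_integral_Delta2_cong[of _ x]; simp)+

lemma mean_Delta_cong:
  assumes [measurable]: "g \<in> borel_measurable borel" and h: "h < h0 U x"
  shows "mean_Delta f x h = mean_Delta g x h"
proof -
  have inner: "(LINT s:{x - t..x + t}|lebesgue. Delta f s t / (2 * t\<^sup>2))
      = (LINT s:{x - t..x + t}|lebesgue. Delta g s t / (2 * t\<^sup>2))" if t: "t \<le> h" for t
  proof -
    have mg: "(\<lambda>s. indicator {x - t..x + t} s *\<^sub>R (Delta g s t / (2 * t\<^sup>2))) \<in> borel_measurable lebesgue"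
      by (rule measurable_completion) measurable
    have "AE s in lborel. t + 1 * s \<notin> N" "AE s in lborel. - t + 1 * s \<notin> N"
      by (rule AE_affine_notin_null_sets[OF N], simp)+
    then have "AE s in lborel. s + t \<notin> N \<and> s - t \<notin> N"
      by eventually_elim (simp add: add.commute)
    then have "AE s in lebesgue. s + t \<notin> N \<and> s - t \<notin> N" by (rule AE_completion)
    \<comment> \<open>Measurability of the integrand with \<open>f\<close> is deduced from this
      equality almost everywhere, by completeness of Lebesgue measure; hence \<open>g\<close> stands
      on the left.\<close>
    then have ae: "AE s in lebesgue. indicator {x - t..x + t} s *\<^sub>R (Delta g s t / (2 * t\<^sup>2))
        = indicator {x - t..x + t} s *\<^sub>R (Delta f s t / (2 * t\<^sup>2))"
    proof eventually_elim
      case (elim s)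
      show ?case
      proof (cases "s \<in> {x - t..x + t}")
        case True
        then have "s + t \<in> U" "s - t \<in> U"
          using t h by (intro in_if_near_h0[of _ x]; auto)+
        then show ?thesis using elim by (simp add: Delta_def eq)
      qed simp
    qed
    show ?thesis
      unfolding set_lebesgue_integral_def
      by (rule integral_cong_AE[OF mg borel_measurable_AE[OF mg ae] ae, symmetric])
  qed
  show ?thesis
    unfolding mean_Delta_def set_lebesgue_integral_def[of lebesgue "{h / 2..h}"]
  proof (intro Bochner_Integration.integral_cong refl)
    fix t
    show "indicator {h / 2..h} t *\<^sub>R (LINT s:{x - t..x + t}|lebesgue. Delta f s t / (2 * t\<^sup>2))
      = indicator {h / 2..h} t *\<^sub>R (LINT s:{x - t..x + t}|lebesgue. Delta g s t / (2 * t\<^sup>2))"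
      by (cases "t \<in> {h / 2..h}") (simp_all only: atLeastAtMost_iff inner indicator_simps, simp)
  qed
qed

text \<open>Square integrability on a bounded interval gives integrability through
  \<open>\<bar>y\<bar> \<le> y^2 + 1\<close>.\<close>

lemma set_integrable_version:
  assumes [measurable]: "g \<in> borel_measurable borel" and L2: "L2_loc U f" and K: "{a..b} \<subseteq> U"
  shows "set_integrable lborel {a..b} g"
proof -
  have "set_integrable lebesgue {a..b} (\<lambda>y. (f y)\<^sup>2)"
    using L2 K by (auto simp: L2_loc_def)
  then have int: "integrable lebesgue (\<lambda>y. indicator {a..b} y *\<^sub>R (f y)\<^sup>2)" by (simp add: set_integrable_def)
  have [measurable]: "(\<lambda>y. indicator {a..b} y *\<^sub>R (g y)\<^sup>2) \<in> borel_measurable lebesgue"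
    by (rule measurable_completion) measurable
  have "AE y in lebesgue. indicator {a..b} y *\<^sub>R (f y)\<^sup>2 = indicator {a..b} y *\<^sub>R (g y)\<^sup>2"
    using AE_completion[OF AE_not_in[OF N]]
    by eventually_elim (use K eq in \<open>auto simp: indicator_def\<close>)
  note ae = this
  have "integrable lebesgue (\<lambda>y. indicator {a..b} y *\<^sub>R (g y)\<^sup>2)"
    by (rule integrable_cong_AE[THEN iffD1, OF borel_measurable_integrable[OF int] _ ae int]) measurable
  then have "integrable lborel (\<lambda>y. indicator {a..b} y *\<^sub>R (g y)\<^sup>2)"
    by (subst (asm) integrable_completion) auto
  moreover have "integrable lborel (\<lambda>y. indicator {a..b} y :: real)"
    by (rule integrable_real_indicator) (auto simp: emeasure_lborel_Icc_eq)
  ultimately have "integrable lborel (\<lambda>y. indicator {a..b} y *\<^sub>R (g y)\<^sup>2 + indicator {a..b} y)" by simp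
  then show ?thesis unfolding set_integrable_def
  proof (rule Bochner_Integration.integrable_bound)
    have "\<bar>g y\<bar> \<le> (g y)\<^sup>2 + 1" for y
    proof -
      have "0 \<le> (\<bar>g y\<bar> - 1)\<^sup>2" by simp
      also have "\<dots> = (g y)\<^sup>2 - 2 * \<bar>g y\<bar> + 1" by (simp add: power2_diff)
      finally show ?thesis using abs_ge_zero[of "g y"] by linarith
    qed
    then show "AE y in lborel. norm (indicator {a..b} y *\<^sub>R g y) \<le> norm (indicator {a..b} y *\<^sub>R (g y)\<^sup>2 + indicator {a..b} y :: real)"
      by (auto simp: indicator_def)
  qed measurable
qed

end

lemma A_sq_trunc_antimono: "h \<le> h' \<Longrightarrow> A_sq_trunc U f x h' \<le> A_sq_trunc U f x h"
  unfolding A_sq_trunc_def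
  by (intro less_eq_ennreal.rep_eq[THEN iffD1] nn_integral_mono mult_left_mono) (auto simp: indicator_def)

text \<open>Monotone convergence along the heights \<open>1 / (n + 1)\<close>, whose truncated cones
  exhaust the cone; monotonicity in \<open>h\<close> covers the other heights.\<close>

lemma A_sq_trunc_at_top:
  assumes [measurable]: "f \<in> borel_measurable borel" and inf: "A_sq U f x = \<infinity>"
  shows "\<forall>\<^sub>F h in at_right 0. ereal Q \<le> A_sq_trunc U f x h"
proof -
  let ?F = "\<lambda>p::real \<times> real. ennreal ((Delta2 f (fst p) (snd p))\<^sup>2 / (snd p)\<^sup>2)"
  let ?C = "\<lambda>n. cone U x \<inter> {p. inverse (real (Suc n)) \<le> snd p}"
  have F [measurable]: "?F \<in> borel_measurable borel"
    unfolding borel_prod[symmetric] by measurable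
  have C [measurable]: "?C n \<in> sets borel" for n
  proof -
    have "?C n = {p \<in> space (borel \<Otimes>\<^sub>M borel). \<bar>fst p - x\<bar> < snd p \<and> snd p < h0 U x \<and> inverse (real (Suc n)) \<le> snd p}"
      by (auto simp: cone_def space_pair_measure)
    also have "\<dots> \<in> sets (borel \<Otimes>\<^sub>M borel)" by measurable
    finally show ?thesis by (simp only: borel_prod)
  qed
  have sup: "(SUP n. ?F p * indicator (?C n) p) = ?F p * indicator (cone U x) p" for p
  proof (cases "p \<in> cone U x")
    case True
    then have "snd p > 0" by (auto simp: cone_def)
    then obtain n where "inverse (real (Suc n)) < snd p" using reals_Archimedean by blast
    then have "p \<in> ?C n" using True by simp
    then show ?thesis using True
      by (intro antisym SUP_least SUP_upper2[of n]) (auto simp: indicator_def)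
  qed (simp add: indicator_def)
  have "(\<integral>\<^sup>+p\<in>cone U x. ?F p \<partial>lebesgue) = (\<integral>\<^sup>+p. (SUP n. ?F p * indicator (?C n) p) \<partial>lebesgue)"
    by (simp only: sup)
  also have "\<dots> = (SUP n. \<integral>\<^sup>+p\<in>?C n. ?F p \<partial>lebesgue)"
  proof (rule nn_integral_monotone_convergence_SUP)
    show "incseq (\<lambda>n p. ?F p * indicator (?C n) p)"
    proof (intro incseq_SucI le_funI mult_left_mono)
      fix n and p :: "real \<times> real"
      have "inverse (real (Suc (Suc n))) \<le> inverse (real (Suc n))" by (intro le_imp_inverse_le) auto
      then have "?C n \<subseteq> ?C (Suc n)" by (blast intro: order_trans)
      then show "indicator (?C n) p \<le> (indicator (?C (Suc n)) p :: ennreal)" by (auto simp: indicator_def)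
    qed simp
    show "(\<lambda>p. ?F p * indicator (?C n) p) \<in> borel_measurable lebesgue" for n
      by (rule measurable_completion) measurable
  qed
  finally have sup_eq: "(\<integral>\<^sup>+p\<in>cone U x. ?F p \<partial>lebesgue) = (SUP n. \<integral>\<^sup>+p\<in>?C n. ?F p \<partial>lebesgue)" .
  have "(\<integral>\<^sup>+p\<in>cone U x. ?F p \<partial>lebesgue) = e2ennreal (A_sq U f x)"
    unfolding A_sq_def by (rule e2ennreal_enn2ereal[symmetric])
  also have "\<dots> = \<infinity>" by (simp only: inf e2ennreal_infty infinity_ennreal_def)
  finally have "(SUP n. \<integral>\<^sup>+p\<in>?C n. ?F p \<partial>lebesgue) = \<infinity>" by (simp only: sup_eq)
  then have "ennreal Q < (SUP n. \<integral>\<^sup>+p\<in>?C n. ?F p \<partial>lebesgue)" by (simp only: infinity_ennreal_def ennreal_less_top)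
  then obtain n where n: "ennreal Q < (\<integral>\<^sup>+p\<in>?C n. ?F p \<partial>lebesgue)"
    unfolding less_SUP_iff by blast
  have "ereal Q \<le> enn2ereal (ennreal Q)" by (simp add: ennreal.rep_eq)
  also have "\<dots> \<le> A_sq_trunc U f x (inverse (real (Suc n)))"
    using n unfolding A_sq_trunc_def by (intro less_eq_ennreal.rep_eq[THEN iffD1]) simp
  finally have "ereal Q \<le> A_sq_trunc U f x h" if "h < inverse (real (Suc n))" for h
    using A_sq_trunc_antimono[of h "inverse (real (Suc n))" U f x] that by simp
  note le = this
  have "\<forall>\<^sub>F h in at_right 0. h \<in> {0<..<inverse (real (Suc n))}"
    by (rule eventually_at_right_real) simp
  then show ?thesis by eventually_elim (simp add: le)
qed

section \<open>The law of the iterated logarithm\<close>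

text \<open>Every small height is \<open>N\<close> halvings below a scale in
  \<open>(d / 2, d]\<close>, so all starting bands lie in the fixed range
  \<open>(d / 4, d]\<close>.\<close>

lemma dyadic_scale:
  fixes h d :: real
  assumes "0 < h" "h \<le> d"
  obtains N where "d / 2 < 2 ^ N * h" "2 ^ N * h \<le> d"
proof -
  have "\<exists>n. d < 2 ^ n * h"
    using real_arch_pow[of 2 "d / h"] assms by (auto simp: field_simps)
  then have ex: "d < 2 ^ (LEAST n. d < 2 ^ n * h) * h" by (rule LeastI_ex)
  define n where "n = (LEAST n. d < 2 ^ n * h)"
  have "n \<noteq> 0" using ex assms unfolding n_def[symmetric] by (intro notI) simp
  then obtain N where N: "n = Suc N" by (cases n) auto
  have "\<not> d < 2 ^ N * h" using N not_less_Least[of N "\<lambda>n. d < 2 ^ n * h"] by (simp add: n_def)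
  then show ?thesis using ex N unfolding n_def[symmetric] by (intro that[of N]) auto
qed

text \<open>With the almost sure bounds as hypotheses nothing probabilistic remains: each small
  \<open>h\<close> is compared with a starting scale near \<open>d\<close>, and the parameter is
  then chosen according to the size of the truncated square function.\<close>

lemma LIL_at_point:
  assumes g [measurable]: "g \<in> borel_measurable borel" and d: "0 < d" "d \<le> 1" "d < h0 U x"
    and int: "set_integrable lborel {x - 2 * d..x + 2 * d} g"
    and ev: "\<forall>\<^sub>F k in sequentially. mean_run_max g (tilt k) (d / 4) d x < ennreal (real (Suc k) powr (9 / 8))"
      "\<forall>\<^sub>F k in sequentially. mean_run_max g (- tilt k) (d / 4) d x < ennreal (real (Suc k) powr (9 / 8))"
    and inf: "A_sq U g x = \<infinity>"
  shows "\<forall>\<^sub>F h in at_right 0. ereal \<bar>mean_Delta g x h\<bar> /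
            esqrt (A_sq_trunc U g x h * eln (eln (A_sq_trunc U g x h))) \<le> ereal (sqrt (2 * ln 2))"
proof -
  obtain K where K: "\<And>k l. k \<ge> K \<Longrightarrow> l \<in> {tilt k, - tilt k} \<Longrightarrow>
      mean_run_max g l (d / 4) d x < ennreal (real (Suc k) powr (9 / 8))"
  proof -
    from ev have "\<forall>\<^sub>F k in sequentially. mean_run_max g (tilt k) (d / 4) d x < ennreal (real (Suc k) powr (9 / 8)) \<and>
       mean_run_max g (- tilt k) (d / 4) d x < ennreal (real (Suc k) powr (9 / 8))" by (rule eventually_conj)
    then show ?thesis using that by (auto simp: eventually_sequentially)
  qed
  have int_slope: "integrable (cone_measure a b) (slope g x)" if "0 < a" "b \<le> d" for a b
  proof (rule integrable_slope[OF g \<open>0 < a\<close>])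
    show "set_integrable lborel {x - 2 * b..x + 2 * b} g"
      by (rule set_integrable_subset[OF int]) (use that in auto)
  qed
  \<comment> \<open>One bound for the mean slope over every starting band, since each lies in
    \<open>(d / 4, d]\<close>.\<close>
  define B where "B = (\<integral>p. \<bar>slope g x p\<bar> \<partial>cone_measure (d / 4) d)"
  have B: "\<bar>\<integral>p. slope g x p \<partial>cone_measure (b / 2) b\<bar> \<le> B" if b: "d / 2 < b" "b \<le> d" for b
  proof -
    have i1: "integrable (cone_measure (b / 2) b) (\<lambda>p. \<bar>slope g x p\<bar>)" "integrable (cone_measure (d / 4) d) (\<lambda>p. \<bar>slope g x p\<bar>)"
      using b d by (auto intro!: integrable_abs int_slope)
    have "\<bar>\<integral>p. slope g x p \<partial>cone_measure (b / 2) b\<bar> \<le> (\<integral>p. \<bar>slope g x p\<bar> \<partial>cone_measure (b / 2) b)"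
      by (rule integral_abs_bound)
    also have "\<dots> \<le> B"
    proof -
      have "(\<integral>\<^sup>+p. ennreal \<bar>slope g x p\<bar> \<partial>cone_measure (b / 2) b) \<le> (\<integral>\<^sup>+p. ennreal \<bar>slope g x p\<bar> \<partial>cone_measure (d / 4) d)"
        using b by (intro nn_integral_cone_measure_mono) auto
      then show ?thesis
        using i1 by (simp add: nn_integral_eq_integral B_def)
    qed
    finally show ?thesis .
  qed
  have key: "tilt k * (2 * \<bar>mean_Delta g x h\<bar> - B) \<le>
        27 / 8 * ln 2 * ln (real (Suc k)) + (tilt k)\<^sup>2 * q / 2"
    if h: "0 < h" "h \<le> d" and q: "A_sq_trunc U g x h = ereal q" and k: "k \<ge> K" for h q k
  proof -
    \<comment> \<open>The sign of \<open>l\<close> is that of the mean divided difference, which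
      yields the bound for its absolute value.\<close>
    define l where "l = (if mean_Delta g x h \<ge> 0 then tilt k else - tilt k)"
    have l2: "l\<^sup>2 = (tilt k)\<^sup>2" by (simp add: l_def)
    obtain N where N: "d / 2 < 2 ^ N * h" "2 ^ N * h \<le> d" using dyadic_scale[OF h] .
    define b where "b = 2 ^ N * h"
    have b: "d / 2 < b" "b \<le> d" "b / 2 ^ N = h" using N by (simp_all add: b_def)
    define I where "I = (\<integral>p. slope g x p \<partial>cone_measure (b / 2) b)"
    have I: "\<bar>I\<bar> \<le> B" unfolding I_def by (rule B[OF b(1,2)])
    have mean: "(\<integral>p. slope g x p \<partial>cone_measure (h / 2) h) = 2 * mean_Delta g x h"
      using mean_Delta_eq[OF g h(1) int_slope] h by simp
    have Q: "(\<integral>\<^sup>+p. ennreal ((slope_jump g x p)\<^sup>2) \<partial>cone_measure h b) \<le> ennreal q"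
    proof -
      have "(\<integral>\<^sup>+p. ennreal ((slope_jump g x p)\<^sup>2) \<partial>cone_measure h b) \<le> e2ennreal (A_sq_trunc U g x h)"
        using nn_integral_slope_jump_le[OF g h(1), of b U x] b d by (simp add: A_sq_trunc_def)
      then show ?thesis using q by simp
    qed
    have "0 \<le> A_sq_trunc U g x h" unfolding A_sq_trunc_def by (rule enn2ereal_nonneg)
    then have q0: "0 \<le> q" using q by simp
    have "ennreal (2 * ln 2 * exp (2 / 3 * (l * (2 * mean_Delta g x h - I) - l\<^sup>2 / 2 * q) / (2 * ln 2)))
       \<le> mean_run_max g l (d / 4) d x"
      unfolding mean[symmetric] I_def unfolding b(3)[symmetric]
    proof (rule exp_slope_le_mean_run_max[OF g _ b(2) _ _ _ _ q0])
      show "0 < b" "d / 4 \<le> b / 2" using b d by auto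
      show "integrable (cone_measure (b / 2) b) (slope g x)" using b d by (intro int_slope) auto
      show "integrable (cone_measure (b / 2 ^ N / 2) (b / 2 ^ N)) (slope g x)" unfolding b(3) using h by (intro int_slope) auto
      show "(\<integral>\<^sup>+p. ennreal ((slope_jump g x p)\<^sup>2) \<partial>cone_measure (b / 2 ^ N) b) \<le> ennreal q" unfolding b(3) by (rule Q)
    qed
    also have "\<dots> < ennreal (real (Suc k) powr (9 / 8))"
      by (rule K[OF k]) (simp add: l_def)
    finally have lt: "2 * ln 2 * exp (2 / 3 * (l * (2 * mean_Delta g x h - I) - l\<^sup>2 / 2 * q) / (2 * ln 2))
       < real (Suc k) powr (9 / 8)" by (simp add: ennreal_less_iff)
    define Y where "Y = 2 / 3 * (l * (2 * mean_Delta g x h - I) - l\<^sup>2 / 2 * q) / (2 * ln 2)"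
    have "1 * exp Y \<le> 2 * ln 2 * exp Y" using ln2_ge_two_thirds by (intro mult_right_mono) auto
    also have "\<dots> < real (Suc k) powr (9 / 8)" using lt by (simp add: Y_def)
    also have "\<dots> = exp (9 / 8 * ln (real (Suc k)))" by (simp add: powr_def)
    finally have "Y < 9 / 8 * ln (real (Suc k))" by simp
    \<comment> \<open>Multiplying by \<open>3/2 * 2 * ln 2 = 3 * ln 2\<close> turns
      \<open>9/8\<close> into \<open>27/8 * ln 2\<close>.\<close>
    then have "l * (2 * mean_Delta g x h - I) \<le> 27 / 8 * ln 2 * ln (real (Suc k)) + l\<^sup>2 * q / 2"
      unfolding Y_def by (simp add: field_simps)
    moreover have "tilt k * (2 * \<bar>mean_Delta g x h\<bar> - B) \<le> l * (2 * mean_Delta g x h - I)"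
    proof -
      have "tilt k \<ge> 0" by (simp add: tilt_def)
      then have "tilt k * (2 * \<bar>mean_Delta g x h\<bar> - B) \<le> tilt k * (2 * \<bar>mean_Delta g x h\<bar> - \<bar>I\<bar>)"
        using I by (intro mult_left_mono) auto
      also have "\<dots> \<le> tilt k * (if mean_Delta g x h \<ge> 0 then 2 * mean_Delta g x h - I else - (2 * mean_Delta g x h - I))"
        using \<open>tilt k \<ge> 0\<close> by (intro mult_left_mono) auto
      also have "\<dots> = l * (2 * mean_Delta g x h - I)" by (simp add: l_def algebra_simps)
      finally show ?thesis .
    qed
    ultimately show ?thesis by (simp add: l2)
  qed
  obtain Q where Q: "\<And>q m. q \<ge> Q \<Longrightarrow> (\<forall>k\<ge>K. tilt k * (2 * m - B) \<le>
        27 / 8 * ln 2 * ln (real (Suc k)) + (tilt k)\<^sup>2 * q / 2) \<Longrightarrow>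
      m \<le> sqrt (2 * ln 2) * sqrt (q * ln (ln q))"
    using iterated_log_optimization[of K B] unfolding eventually_at_top_linorder by blast
  \<comment> \<open>The bound \<open>exp (exp 1)\<close> ensures \<open>ln (ln q) \<ge> 1\<close>,
    so that the denominator is positive.\<close>
  have "\<forall>\<^sub>F h in at_right 0. ereal (max Q (exp (exp 1))) \<le> A_sq_trunc U g x h"
    by (rule A_sq_trunc_at_top[OF g inf])
  moreover have "\<forall>\<^sub>F h in at_right 0. h \<in> {0<..<d}" by (rule eventually_at_right_real[OF d(1)])
  ultimately show ?thesis
  proof eventually_elim
    case (elim h)
    show ?case
    proof (cases "A_sq_trunc U g x h")
      case (real q)
      have q: "q \<ge> Q" "q \<ge> exp (exp 1)" using elim(1) real by auto
      have q0: "q > 0" using q(2) exp_gt_zero[of "exp 1 :: real"] by linarith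
      have lnq: "ln q \<ge> exp 1" using q q0 by (simp add: ln_ge_iff)
      have lnq0: "ln q > 0" using lnq exp_gt_zero[of "1::real"] by linarith
      have lnlnq: "ln (ln q) \<ge> 1" using lnq lnq0 by (simp add: ln_ge_iff)
      have pos: "sqrt (q * ln (ln q)) > 0" using q0 lnlnq by simp
      have "\<bar>mean_Delta g x h\<bar> \<le> sqrt (2 * ln 2) * sqrt (q * ln (ln q))"
        using elim(2) key[OF _ _ real] by (intro Q[OF q(1)]) auto
      then have "\<bar>mean_Delta g x h\<bar> / sqrt (q * ln (ln q)) \<le> sqrt (2 * ln 2)"
        using pos by (simp add: pos_divide_le_eq)
      moreover have "ereal \<bar>mean_Delta g x h\<bar> / esqrt (A_sq_trunc U g x h * eln (eln (A_sq_trunc U g x h)))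
         = ereal (\<bar>mean_Delta g x h\<bar> / sqrt (q * ln (ln q)))"
        using q0 lnlnq by (auto simp: real eln_def esqrt_def)
      ultimately show ?thesis by simp
    next
      case PInf
      \<comment> \<open>An infinite truncation makes the denominator infinite and the quotient
        0.\<close>
      then show ?thesis by (simp add: eln_def esqrt_def)
    next
      case MInf
      then show ?thesis using elim(1) unfolding MInf by (simp add: max_def split: if_splits)
    qed
  qed
qed

theorem theorem1:
  fixes U :: "real set" and f :: "real \<Rightarrow> real"
  assumes "open U" and "L2_loc U f"
  shows "AE x in lebesgue. x \<in> U \<and> A U f x = \<infinity> \<longrightarrow>
    Limsup (at_right 0)
      (\<lambda>h. ereal \<bar>mean_Delta f x h\<bar> /
            esqrt (A_sq_trunc U f x h * eln (eln (A_sq_trunc U f x h))))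
    \<le> ereal (sqrt (2 * ln 2))"
proof -
  obtain g N where g: "g \<in> borel_measurable borel" and N: "N \<in> null_sets lborel"
    and eq: "\<And>y. y \<in> U \<Longrightarrow> y \<notin> N \<Longrightarrow> f y = g y"
    using Borel_version[OF assms(1)] assms(2) unfolding L2_loc_def by blast
  \<comment> \<open>The starting scale must be below \<open>h0 U x\<close>, which depends on
    \<open>x\<close>; countably many scales suffice and keep the exceptional set null.\<close>
  define d :: "nat \<Rightarrow> real" where "d n = inverse (real (Suc n))" for n
  have d: "0 < d n" "d n \<le> 1" for n by (auto simp: d_def inverse_le_1_iff)
  have "AE x in lborel. \<forall>n. (\<forall>\<^sub>F k in sequentially. mean_run_max g (tilt k) (d n / 4) (d n) x < ennreal (real (Suc k) powr (9 / 8)))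
     \<and> (\<forall>\<^sub>F k in sequentially. mean_run_max g (- tilt k) (d n / 4) (d n) x < ennreal (real (Suc k) powr (9 / 8)))"
    unfolding AE_all_countable
  proof (intro allI AE_conjI)
    fix n
    have "0 < d n / 4" "d n / 4 \<le> d n" "d n \<le> 1" using d[of n] by auto
    note * = AE_eventually_mean_run_max_less[OF g this]
    show "AE x in lborel. \<forall>\<^sub>F k in sequentially. mean_run_max g (tilt k) (d n / 4) (d n) x < ennreal (real (Suc k) powr (9 / 8))"
      "AE x in lborel. \<forall>\<^sub>F k in sequentially. mean_run_max g (- tilt k) (d n / 4) (d n) x < ennreal (real (Suc k) powr (9 / 8))"
      by (rule *)+
  qed
  then have "AE x in lebesgue. \<forall>n. (\<forall>\<^sub>F k in sequentially. mean_run_max g (tilt k) (d n / 4) (d n) x < ennreal (real (Suc k) powr (9 / 8)))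
     \<and> (\<forall>\<^sub>F k in sequentially. mean_run_max g (- tilt k) (d n / 4) (d n) x < ennreal (real (Suc k) powr (9 / 8)))"
    by (rule AE_completion)
  then show ?thesis
  proof eventually_elim
    case (elim x)
    show ?case
    proof (intro impI Limsup_bounded)
      assume x: "x \<in> U \<and> A U f x = \<infinity>"
      then obtain n where n: "d n < h0 U x"
        using reals_Archimedean[OF h0_pos[OF assms(1), of x]] by (auto simp: d_def)
      have "A_sq U f x = \<infinity>" using x by (auto simp: A_def esqrt_def split: if_splits)
      then have inf: "A_sq U g x = \<infinity>" using A_sq_cong[OF N eq] by simp
      have "y \<in> U" if "y \<in> {x - 2 * d n..x + 2 * d n}" for y
        using that n by (intro in_if_near_h0[of y x U]) auto
      then have int: "set_integrable lborel {x - 2 * d n..x + 2 * d n} g"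
        by (intro set_integrable_version[OF N eq g assms(2)]) auto
      have "\<forall>\<^sub>F h in at_right 0. ereal \<bar>mean_Delta g x h\<bar> /
            esqrt (A_sq_trunc U g x h * eln (eln (A_sq_trunc U g x h))) \<le> ereal (sqrt (2 * ln 2))"
        by (rule LIL_at_point[OF g d n int _ _ inf]) (use elim in auto)
      moreover have "\<forall>\<^sub>F h in at_right 0. h \<in> {0<..<d n}" by (rule eventually_at_right_real[OF d(1)])
      ultimately show "\<forall>\<^sub>F h in at_right 0. ereal \<bar>mean_Delta f x h\<bar> /
            esqrt (A_sq_trunc U f x h * eln (eln (A_sq_trunc U f x h))) \<le> ereal (sqrt (2 * ln 2))"
      proof eventually_elim
        case (elim h)
        have "mean_Delta f x h = mean_Delta g x h"
          by (rule mean_Delta_cong[OF N eq g]) (use elim n in auto)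
        moreover have "A_sq_trunc U f x h = A_sq_trunc U g x h" by (rule A_sq_trunc_cong[OF N eq])
        ultimately show ?case using elim by simp
      qed
    qed
  qed
qed

end
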